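(* Let $k\ge 1$ be a fixed integer and $\epsilon\in\{-1,1\}$. Put $M_k=k\prod_{p\le k}p$ (product over primes $p\le k$). Then $$M(a_n^{\epsilon}(k))=\frac{3}{\pi^2\prod_{p\le k}(1+\frac1p)}\sum_{d\mid M_k}\frac{a_{d}^1(k)+a_{d}^{-1}(k)}{d}.$$ Furthermore, for every integer $v\ne 0$, $$\delta(a_n^{\epsilon}(k)=v)=\frac{3}{\pi^2\prod_{p\le k}(1+\frac1p)}\Big(\sum_{d\mid M_k,\; a_{d}^1(k)=v}\frac1d+\sum_{d\mid M_k,\; a_{d}^{-1}(k)=v}\frac1d\Big).$$ (In particular the limits defining the left-hand sides exist.)
   Context: For $\epsilon\in\{-1,1\}$ and $n\ge1$, $a_n^{\epsilon}(k)$ denotes the $k$th Taylor coefficient around $x=0$ of $\prod_{d\mid n}(1-x^d)^{\epsilon\mu(n/d)}$, where $\mu$ is the Möbius function. (For $n>1$, $a_n^1(k)$ is the coefficient of $x^k$ in the $n$th cyclotomic polynomial $\Phi_n(x)$, and $a_n^{-1}(k)$ is the coefficient of $x^k$ in the Taylor series of $1/\Phi_n(x)$.) Averages and densities are taken over $n$: $M(f(n))=\lim_{x\to\infty}\frac1x\sum_{n\le x}f(n)$ and $\delta(f(n)=v)=\lim_{x\to\infty}\frac1x\#\{n\le x: f(n)=v\}$. Empty products equal $1$. *)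

theory Defs
  imports "HOL-Analysis.Analysis" "HOL-Computational_Algebra.Squarefree"
begin

definition moebius_mu :: "nat \<Rightarrow> int" where
  "moebius_mu n = (if squarefree n then (-1) ^ card (prime_factors n) else 0)"

definition taylor_coeff :: "(real \<Rightarrow> real) \<Rightarrow> nat \<Rightarrow> real" where
  "taylor_coeff f k = (deriv ^^ k) f 0 / fact k"

text \<open>
  The factors vanish at most for \<open>x = 1\<close> and \<open>x = -1\<close>. Away from these points and for \<open>n > 1\<close>,
  \<open>cyclo_fun 1 n\<close> is the \<open>n\<close>-th cyclotomic polynomial and \<open>cyclo_fun (-1) n\<close> its
  reciprocal; at these points the convention \<open>inverse 0 = 0\<close> yields other values, which do not
  affect the Taylor coefficients at \<open>0\<close>. For \<open>n = 1\<close> the functions are \<open>1 - x\<close> and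
  \<open>1 / (1 - x)\<close>, which differ in sign from the cyclotomic ones.
\<close>

definition cyclo_fun :: "int \<Rightarrow> nat \<Rightarrow> real \<Rightarrow> real" where
  "cyclo_fun \<epsilon> n x = (\<Prod>d | d dvd n. (1 - x ^ d) powi (\<epsilon> * moebius_mu (n div d)))"

definition cyclo_coeff :: "int \<Rightarrow> nat \<Rightarrow> nat \<Rightarrow> real" where
  "cyclo_coeff \<epsilon> n k = taylor_coeff (cyclo_fun \<epsilon> n) k"

text \<open>
  The mean value and the natural density are relations, so that a statement
  \<open>has_mean_value f L\<close> or \<open>has_density P L\<close> includes the existence of the limit.
\<close>

definition has_mean_value :: "(nat \<Rightarrow> real) \<Rightarrow> real \<Rightarrow> bool" where
  "has_mean_value f L \<longleftrightarrow>
     ((\<lambda>x::real. (1 / x) * (\<Sum>n | 1 \<le> n \<and> real n \<le> x. f n)) \<longlongrightarrow> L) at_top"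

definition has_density :: "(nat \<Rightarrow> bool) \<Rightarrow> real \<Rightarrow> bool" where
  "has_density P L \<longleftrightarrow>
     ((\<lambda>x::real. (1 / x) * real (card {n. 1 \<le> n \<and> real n \<le> x \<and> P n})) \<longlongrightarrow> L) at_top"

definition big_M :: "nat \<Rightarrow> nat" where
  "big_M k = k * (\<Prod>p | prime p \<and> p \<le> k. p)"


text \<open>The coefficients can also be read off from the product in the ring of formal power series.\<close>

lemma higher_deriv_has_fps_expansion:
  fixes f :: "real \<Rightarrow> real"
  assumes "f has_fps_expansion F"
  shows "(deriv ^^ k) f has_fps_expansion (fps_deriv ^^ k) F"
  using assms by (induction k) (auto intro: has_fps_expansion_deriv)

lemma taylor_coeff_eq_fps_nth:
  assumes "f has_fps_expansion F"
  shows "taylor_coeff f k = fps_nth F k"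
proof -
  have "(deriv ^^ k) f has_fps_expansion (fps_deriv ^^ k) F"
    using assms by (rule higher_deriv_has_fps_expansion)
  hence "(deriv ^^ k) f 0 = fps_nth ((fps_deriv ^^ k) F) 0"
    by (auto simp: has_fps_expansion_def eval_fps_at_0 dest: eventually_nhds_x_imp_x)
  thus ?thesis
    by (simp add: taylor_coeff_def fps_0th_higher_deriv)
qed

lemma has_fps_expansion_power_nat:
  fixes f :: "real \<Rightarrow> real"
  assumes "f has_fps_expansion F"
  shows "(\<lambda>x. f x ^ m) has_fps_expansion F ^ m"
  using assms by (induction m) (auto intro!: has_fps_expansion_mult)

lemma has_fps_expansion_power_int:
  fixes f :: "real \<Rightarrow> real"
  assumes "f has_fps_expansion F" "fps_nth F 0 \<noteq> 0"
  shows "(\<lambda>x. f x powi i) has_fps_expansion F powi i"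
  using assms unfolding power_int_def
  by (auto intro!: has_fps_expansion_power_nat has_fps_expansion_inverse)

lemma cyclo_coeff_eq_fps_nth:
  assumes "n \<ge> 1"
  shows "cyclo_coeff \<epsilon> n k =
           fps_nth (\<Prod>d | d dvd n. (1 - fps_X ^ d) powi (\<epsilon> * moebius_mu (n div d))) k"
  unfolding cyclo_coeff_def
proof (rule taylor_coeff_eq_fps_nth)
  have "(\<lambda>x::real. \<Prod>d | d dvd n. (1 - x ^ d) powi (\<epsilon> * moebius_mu (n div d)))
          has_fps_expansion (\<Prod>d | d dvd n. (1 - fps_X ^ d) powi (\<epsilon> * moebius_mu (n div d)))"
  proof (intro has_fps_expansion_prod has_fps_expansion_power_int has_fps_expansion_diff
               has_fps_expansion_1 has_fps_expansion_fps_X_power)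
    fix d assume "d \<in> {d. d dvd n}"
    with assms have "d > 0"
      by (auto intro: Nat.gr0I)
    thus "fps_nth (1 - fps_X ^ d :: real fps) 0 \<noteq> 0"
      by simp
  qed
  thus "cyclo_fun \<epsilon> n has_fps_expansion
          (\<Prod>d | d dvd n. (1 - fps_X ^ d) powi (\<epsilon> * moebius_mu (n div d)))"
    by (simp add: cyclo_fun_def [abs_def])
qed

end

theory Submission
  imports Defs "HOL-Real_Asymp.Real_Asymp" "HOL-Number_Theory.Prime_Powers"
    "HOL-Complex_Analysis.Complex_Analysis"
begin

text \<open>
  Write \<open>n = s m\<close>, where all prime factors of \<open>s\<close> are at most \<open>k\<close> and all those of \<open>m\<close> exceed \<open>k\<close>.
  Modulo \<open>x\<^bsup>k+1\<^esup>\<close> only the factors with \<open>d \<le> k\<close> survive; such \<open>d\<close> divide \<open>s\<close>, and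
  \<open>\<mu>(n/d) = \<mu>(m) \<mu>(s/d)\<close>. Hence the \<open>k\<close>-th coefficient for \<open>n\<close> and \<open>\<epsilon>\<close> is the one for \<open>s\<close> and
  \<open>\<epsilon> \<mu>(m)\<close> (\<open>cyclo_coeff_smooth_rough\<close>), and it is \<open>0\<close> if \<open>\<mu>(m) = 0\<close>. If it does not vanish, then \<open>s\<close>
  divides \<open>M\<^sub>k\<close>: every factor with a nonzero exponent is a power series in \<open>x\<^sup>q\<close> for
  \<open>q = s / gcd s (\<Prod>p\<le>k. p)\<close>, which forces \<open>q dvd k\<close> (\<open>cyclo_coeff_nonzero_imp_dvd_big_M\<close>).
  So the coefficient takes finitely many nonzero values, each on a finite union of sets of the form
  \<open>{s m | m free of primes \<le> k, \<mu>(m) = \<plusminus>1}\<close> with \<open>s dvd M\<^sub>k\<close>, and everything reduces to the density of these sets,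
  which is \<open>1/s\<close> times the density of the possible \<open>m\<close>.

  That density is \<open>3/\<pi>\<^sup>2 \<Prod>p\<le>k. (1+1/p)\<^bsup>-1\<^esup>\<close> for either sign (\<open>mean_moebius_eq_coprime\<close>): the numbers
  with \<open>\<mu>(m) \<noteq> 0\<close> are the squarefree ones, of density \<open>6/\<pi>\<^sup>2\<close>; excluding a prime \<open>p\<close> divides this by
  \<open>1 + 1/p\<close>; and the two signs are equally frequent because \<open>\<mu>\<close> has mean value \<open>0\<close>.

  The last fact is equivalent to the prime number theorem (for \<open>k = 1\<close> it is part of the assertion).
  It is proved analytically. The function \<open>(s-1) \<zeta>(s)\<close> extends holomorphically to \<open>Re s > 0\<close> and has no
  zeros for \<open>Re s \<ge> 1\<close>, by the inequality \<open>3 + 4 cos \<theta> + cos 2\<theta> \<ge> 0\<close> applied to the Dirichlet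
  series of the von Mangoldt function (\<open>zeta_reg_nonzero\<close>). Thus \<open>\<Sum>\<mu>(n)/n\<^sup>s = 1/\<zeta>(s)\<close> extends
  holomorphically across the line \<open>Re s = 1\<close> and vanishes at \<open>s = 1\<close>. Newman's contour integral argument
  (\<open>newman_tauberian\<close>) yields \<open>\<Sum>\<mu>(n)/n = 0\<close>, and Abel summation gives the mean value.
\<close>

section \<open>The Moebius function\<close>

lemma moebius_mu_1 [simp]: "moebius_mu 1 = 1" "moebius_mu (Suc 0) = 1"
  by (simp_all add: moebius_mu_def)

lemma moebius_mu_mult:
  assumes "coprime a b"
  shows "moebius_mu (a * b) = moebius_mu a * moebius_mu b"
proof (cases "squarefree a \<and> squarefree b")
  case True
  hence nz: "a \<noteq> 0" "b \<noteq> 0"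
    by (metis not_squarefree_0)+
  have "prime_factors a \<inter> prime_factors b = {}"
    using assms by (auto simp: in_prime_factors_iff dest: coprime_common_divisor_nat)
  thus ?thesis
    using True nz assms
    by (simp add: moebius_mu_def squarefree_mult_coprime prime_factors_product card_Un_disjoint power_add)
next
  case False
  thus ?thesis
    by (auto simp: moebius_mu_def dest: squarefree_multD)
qed

lemma moebius_mu_cases: "moebius_mu n \<in> {-1, 0, 1}"
  by (cases "even (card (prime_factors n))") (auto simp: moebius_mu_def)

lemma abs_moebius_mu_le_1: "\<bar>real_of_int (moebius_mu n)\<bar> \<le> 1"
  using moebius_mu_cases[of n] by auto

lemma norm_moebius_mu_le_1: "norm (of_int (moebius_mu n) :: complex) \<le> 1"
  using moebius_mu_cases[of n] by auto

lemma moebius_mu_prime_mult: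
  assumes "prime p"
  shows "moebius_mu (p * n) = (if p dvd n then 0 else - moebius_mu n)"
proof (cases "p dvd n")
  case True
  hence "p ^ 2 dvd p * n"
    by (auto simp: power2_eq_square)
  hence "\<not> squarefree (p * n)"
    using assms by (intro not_squarefreeI[of p]) (auto dest: not_prime_unit)
  with True show ?thesis
    by (simp add: moebius_mu_def)
next
  case False
  have "moebius_mu p = -1"
    using assms by (simp add: moebius_mu_def squarefree_prime prime_factorization_prime)
  with False assms show ?thesis
    by (subst moebius_mu_mult) (auto simp: prime_imp_coprime)
qed

text \<open>
  Fix a prime factor \<open>p\<close> of \<open>n\<close>. Divisors \<open>d\<close> divisible by \<open>p\<^sup>2\<close> contribute nothing, and the others
  cancel in pairs \<open>d, p * d\<close> with \<open>d\<close> prime to \<open>p\<close>.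
\<close>

lemma sum_moebius_mu_divisors:
  assumes "n > 0"
  shows "(\<Sum>d | d dvd n. moebius_mu d) = (if n = 1 then 1 else 0)"
proof (cases "n = 1")
  case False
  then obtain p where p: "prime p" "p dvd n"
    using prime_factor_nat by blast
  define A where "A = {d. d dvd n \<and> \<not> p dvd d}"
  define B where "B = {d. d dvd n \<and> p dvd d}"
  have fin: "finite A" "finite B"
    using assms by (auto simp: A_def B_def)
  have p0: "p > 0"
    using p prime_gt_0_nat by blast
  have "(\<Sum>d\<in>B. moebius_mu d) = (\<Sum>d\<in>(\<lambda>d. p * d) ` A. moebius_mu d)"
  proof (intro sum.mono_neutral_right fin ballI)
    have "p * d dvd n" if "d dvd n" "\<not> p dvd d" for d
      using that p by (intro divides_mult) (auto simp: prime_imp_coprime)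
    thus "(*) p ` A \<subseteq> B"
      by (auto simp: A_def B_def)
  next
    fix d assume d: "d \<in> B - (*) p ` A"
    then obtain e where e: "d = p * e"
      by (auto simp: B_def)
    with d have "p dvd e"
      by (auto simp: A_def B_def dest: dvd_mult_right)
    thus "moebius_mu d = 0"
      using p e by (simp add: moebius_mu_prime_mult)
  qed
  also have "\<dots> = (\<Sum>d\<in>A. - moebius_mu d)"
    using p p0 by (subst sum.reindex) (auto simp: inj_on_def A_def moebius_mu_prime_mult)
  finally have "(\<Sum>d\<in>B. moebius_mu d) = - (\<Sum>d\<in>A. moebius_mu d)"
    by (simp add: sum_negf)
  moreover have "{d. d dvd n} = A \<union> B" "A \<inter> B = {}"
    by (auto simp: A_def B_def)
  ultimately show ?thesis
    using False fin by (simp add: sum.union_disjoint)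
qed simp

text \<open>
  The \<open>d\<close> with \<open>d\<^sup>2 dvd n\<close> are the divisors of the square root of the largest square dividing \<open>n\<close>,
  so \<open>sum_moebius_mu_divisors\<close> applies.
\<close>

lemma of_bool_squarefree_eq_sum:
  fixes n :: nat
  assumes "n > 0"
  shows "of_bool (squarefree n) = (\<Sum>d | d\<^sup>2 dvd n. moebius_mu d)"
proof -
  have sq: "square_part n > 0"
    using assms by (auto intro: Nat.gr0I)
  have "squarefree n \<longleftrightarrow> square_part n = 1"
  proof
    assume "squarefree n"
    thus "square_part n = 1"
      using squarefreeD[of n "square_part n"] by auto
  next
    assume "square_part n = 1"
    thus "squarefree n"
      using dvd_square_part_iff[of _ n] by (intro squarefreeI) auto
  qed
  thus ?thesis
    using sum_moebius_mu_divisors[OF sq] by (simp add: dvd_square_part_iff)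
qed

section \<open>Mean values\<close>

text \<open>
  All averages are computed along integers \<open>N\<close>; passing to real \<open>x\<close> only costs the factor
  \<open>\<lfloor>x\<rfloor> / x\<close>, which tends to \<open>1\<close>.
\<close>

lemma LIMSEQ_imp_has_mean_value:
  assumes "(\<lambda>N. (\<Sum>n=1..N. f n) / real N) \<longlonglongrightarrow> L"
  shows "has_mean_value f L"
proof -
  have fl: "filterlim (\<lambda>x::real. nat \<lfloor>x\<rfloor>) sequentially at_top"
    by (intro filterlim_compose[OF filterlim_nat_sequentially] filterlim_floor_sequentially)
  have "((\<lambda>x::real. (\<Sum>n=1..nat \<lfloor>x\<rfloor>. f n) / real (nat \<lfloor>x\<rfloor>)) \<longlongrightarrow> L) at_top"
    using filterlim_compose[OF assms fl] by simp
  moreover have "((\<lambda>x::real. real (nat \<lfloor>x\<rfloor>) / x) \<longlongrightarrow> 1) at_top"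
    by real_asymp
  ultimately have "((\<lambda>x. (\<Sum>n=1..nat \<lfloor>x\<rfloor>. f n) / real (nat \<lfloor>x\<rfloor>) * (real (nat \<lfloor>x\<rfloor>) / x)) \<longlongrightarrow> L * 1) at_top"
    by (rule tendsto_mult)
  moreover have "\<forall>\<^sub>F x in at_top. (\<Sum>n=1..nat \<lfloor>x\<rfloor>. f n) / real (nat \<lfloor>x\<rfloor>) * (real (nat \<lfloor>x\<rfloor>) / x)
                   = (1 / x) * (\<Sum>n | 1 \<le> n \<and> real n \<le> x. f n)"
    using eventually_ge_at_top[of 1]
  proof eventually_elim
    case (elim x)
    have "{n. 1 \<le> n \<and> real n \<le> x} = {1..nat \<lfloor>x\<rfloor>}"
      using elim by (auto simp: le_nat_floor le_nat_iff le_floor_iff)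
    moreover have "nat \<lfloor>x\<rfloor> \<noteq> 0"
      using elim by auto
    ultimately show ?case
      by simp
  qed
  ultimately show ?thesis
    unfolding has_mean_value_def using Lim_transform_eventually by fastforce
qed

lemma has_density_iff_has_mean_value:
  "has_density P L \<longleftrightarrow> has_mean_value (\<lambda>n. of_bool (P n)) L"
proof -
  have "(\<Sum>n | 1 \<le> n \<and> real n \<le> x. of_bool (P n)) = real (card {n. 1 \<le> n \<and> real n \<le> x \<and> P n})" for x
  proof -
    have "finite {n. 1 \<le> n \<and> real n \<le> x}"
      by (rule finite_subset[of _ "{..nat \<lfloor>x\<rfloor>}"]) (auto simp: le_nat_floor)
    moreover have "{n. 1 \<le> n \<and> real n \<le> x} \<inter> {n. P n} = {n. 1 \<le> n \<and> real n \<le> x \<and> P n}"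
      by auto
    ultimately show ?thesis
      by (simp add: sum_of_bool_eq)
  qed
  thus ?thesis
    by (simp add: has_density_def has_mean_value_def)
qed

lemma LIMSEQ_div_nat:
  assumes "s > 0"
  shows "(\<lambda>N. real (N div s) / real N) \<longlonglongrightarrow> 1 / real s"
proof (rule tendsto_sandwich[where f = "\<lambda>N. 1 / real s - 1 / real N" and h = "\<lambda>_. 1 / real s"])
  have *: "real (N div s) \<le> real N / real s" "real N / real s \<le> real (N div s) + 1" for N
  proof -
    have "real (N div s) * s \<le> real N" using div_times_less_eq_dividend[of N s]
      by (metis of_nat_le_iff of_nat_mult)
    thus "real (N div s) \<le> real N / real s" using assms by (simp add: field_simps)
    have "N < (N div s + 1) * s" using assms by (simp add: dividend_less_div_times add.commute)
    hence "real N < (real (N div s) + 1) * real s"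
      by (metis of_nat_1 of_nat_add of_nat_less_iff of_nat_mult)
    thus "real N / real s \<le> real (N div s) + 1" using assms by (simp add: field_simps)
  qed
  show "\<forall>\<^sub>F N in sequentially. 1 / real s - 1 / real N \<le> real (N div s) / real N"
    using eventually_gt_at_top[of 0]
  proof eventually_elim
    case (elim N)
    have "(real N / real s - 1) / N \<le> real (N div s) / real N"
      using *(2)[of N] elim by (intro divide_right_mono) auto
    thus ?case using elim by (simp add: field_simps)
  qed
  show "\<forall>\<^sub>F N in sequentially. real (N div s) / real N \<le> 1 / real s"
    using eventually_gt_at_top[of 0]
  proof eventually_elim
    case (elim N)
    have "real (N div s) / real N \<le> (real N / real s) / N"
      using *(1)[of N] elim by (intro divide_right_mono) auto
    thus ?case using elim by (simp add: field_simps)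
  qed
  show "(\<lambda>N. 1 / real s - 1 / real N) \<longlonglongrightarrow> 1 / real s"
    by real_asymp
qed auto

lemma filterlim_div_nat:
  assumes "(s::nat) > 0"
  shows "filterlim (\<lambda>N. N div s) sequentially sequentially"
  unfolding filterlim_at_top
proof
  fix Z
  show "\<forall>\<^sub>F N in sequentially. Z \<le> N div s"
    using eventually_ge_at_top[of "Z * s"]
    by eventually_elim (use assms in \<open>simp add: less_eq_div_iff_mult_less_eq\<close>)
qed

lemma sum_multiples:
  fixes f :: "nat \<Rightarrow> 'a :: comm_monoid_add"
  assumes "s > 0"
  shows "(\<Sum>n=1..N. if s dvd n then f (n div s) else 0) = (\<Sum>m=1..N div s. f m)"
proof -
  have "(\<Sum>n=1..N. if s dvd n then f (n div s) else 0) = (\<Sum>n\<in>{n\<in>{1..N}. s dvd n}. f (n div s))"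
    by (rule sum.inter_filter[symmetric]) auto
  also have "\<dots> = (\<Sum>m=1..N div s. f m)"
    by (rule sum.reindex_bij_witness[of _ "\<lambda>m. s * m" "\<lambda>n. n div s"])
       (use assms in \<open>auto simp: div_le_mono less_eq_div_iff_mult_less_eq mult.commute
          elim!: dvdE\<close>)
  finally show ?thesis .
qed

lemma LIMSEQ_mean_multiples:
  assumes "s > 0" and "(\<lambda>N. (\<Sum>n=1..N. f n) / real N) \<longlonglongrightarrow> L"
  shows "(\<lambda>N. (\<Sum>n=1..N. if s dvd n then f (n div s) else 0) / real N) \<longlonglongrightarrow> L / real s"
proof -
  have "(\<lambda>N. (\<Sum>n=1..N div s. f n) / real (N div s) * (real (N div s) / real N)) \<longlonglongrightarrow> L * (1 / real s)"
    by (intro tendsto_mult LIMSEQ_div_nat assms filterlim_compose[OF assms(2) filterlim_div_nat])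
  moreover have "\<forall>\<^sub>F N in sequentially. (\<Sum>n=1..N div s. f n) / real (N div s) * (real (N div s) / real N)
       = (\<Sum>n=1..N. if s dvd n then f (n div s) else 0) / real N"
    using eventually_ge_at_top[of s]
    by eventually_elim (use assms(1) in \<open>simp add: sum_multiples div_eq_0_iff del: One_nat_def\<close>)
  ultimately show ?thesis
    using Lim_transform_eventually by fastforce
qed

section \<open>Dirichlet series\<close>

lemma norm_of_nat_powr [simp]: "norm ((of_nat n :: complex) powr s) = real n powr Re s"
  by (cases "n = 0") (simp_all add: norm_powr_real_powr)

text \<open>
  The double series converges absolutely, so it may be summed along the hyperbolas \<open>x y = n\<close>. The index
  \<open>0\<close> is harmless, because \<open>0 powr (-s) = 0\<close>.
\<close>

lemma dirichlet_series_mult: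
  fixes a b :: "nat \<Rightarrow> complex"
  assumes a: "summable (\<lambda>n. norm (a n * of_nat n powr (-s)))"
    and b: "summable (\<lambda>n. norm (b n * of_nat n powr (-s)))"
  shows "(\<lambda>n. (\<Sum>d | d dvd n. a d * b (n div d)) * of_nat n powr (-s)) sums
           ((\<Sum>n. a n * of_nat n powr (-s)) * (\<Sum>n. b n * of_nat n powr (-s)))"
proof -
  define A where "A = (\<lambda>n. a n * of_nat n powr (-s))"
  define B where "B = (\<lambda>n. b n * of_nat n powr (-s))"
  let ?P = "{0<..} :: nat set"
  \<comment> \<open>The index \<open>0\<close> has infinitely many divisors, so it is removed before reindexing.\<close>
  have sum_pos: "(f has_sum c) UNIV \<longleftrightarrow> (f has_sum c) ?P"
    if "f 0 = 0" for f :: "nat \<Rightarrow> 'b :: {comm_monoid_add, topological_space}" and c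
    by (rule has_sum_cong_neutral) (use that in auto)
  have A: "(A has_sum suminf A) ?P" and B: "(B has_sum suminf B) ?P"
    using a b sum_pos[of A] sum_pos[of B]
    by (auto simp: A_def B_def intro!: norm_summable_imp_has_sum summable_sums summable_norm_cancel)
  have "((\<lambda>n. norm (A n)) has_sum (\<Sum>n. norm (A n))) UNIV"
    and "((\<lambda>n. norm (B n)) has_sum (\<Sum>n. norm (B n))) UNIV"
    using a b by (auto simp: A_def B_def intro!: norm_summable_imp_has_sum summable_sums)
  hence nA: "((\<lambda>n. norm (A n)) has_sum (\<Sum>n. norm (A n))) ?P"
    and nB: "((\<lambda>n. norm (B n)) has_sum (\<Sum>n. norm (B n))) ?P"
    using sum_pos[of "\<lambda>n. norm (A n)"] sum_pos[of "\<lambda>n. norm (B n)"] by (auto simp: A_def B_def)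
  have "(\<lambda>(x, y). norm (A x) * norm (B y)) summable_on ?P \<times> ?P"
  proof (rule summable_on_SigmaI)
    show "((\<lambda>y. case (x, y) of (x, y) \<Rightarrow> norm (A x) * norm (B y)) has_sum
             norm (A x) * (\<Sum>n. norm (B n))) ?P" for x
      using has_sum_cmult_right[OF nB] by simp
    show "(\<lambda>x. norm (A x) * (\<Sum>n. norm (B n))) summable_on ?P"
      using has_sum_cmult_left[OF nA] has_sum_imp_summable by blast
  qed auto
  hence "(\<lambda>(x, y). A x * B y) summable_on ?P \<times> ?P"
    by (intro abs_summable_summable[of "\<lambda>(x, y). A x * B y"]) (simp add: case_prod_unfold norm_mult)
  hence "((\<lambda>(x, y). A x * B y) has_sum (suminf A * suminf B)) (?P \<times> ?P)"
    using has_sum_cmult_right[OF B] has_sum_cmult_left[OF A]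
    by (intro has_sum_SigmaI[where g = "\<lambda>x. A x * suminf B"]) auto
  also have "?this \<longleftrightarrow> ((\<lambda>(n, d). A d * B (n div d)) has_sum (suminf A * suminf B))
                        (Sigma ?P (\<lambda>n. {d. d dvd n}))"
    by (rule has_sum_reindex_bij_witness[of _ "\<lambda>(n, d). (d, n div d)" "\<lambda>(x, y). (x * y, x)"])
       (auto elim!: dvdE)
  finally have "((\<lambda>n. \<Sum>d | d dvd n. A d * B (n div d)) has_sum (suminf A * suminf B)) ?P"
    by (rule has_sum_SigmaD) (auto intro!: has_sum_finiteI)
  also have "?this \<longleftrightarrow> ((\<lambda>n. (\<Sum>d | d dvd n. a d * b (n div d)) * of_nat n powr (-s)) has_sum
                         (suminf A * suminf B)) ?P"
  proof (rule has_sum_cong)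
    fix n :: nat assume n: "n \<in> ?P"
    have "A d * B (n div d) = a d * b (n div d) * of_nat n powr (-s)" if "d dvd n" for d
    proof -
      have "(of_nat n :: complex) = of_nat d * of_nat (n div d)"
        using that by (metis dvd_mult_div_cancel of_nat_mult)
      hence "(of_nat n :: complex) powr (-s) = of_nat d powr (-s) * of_nat (n div d) powr (-s)"
        by (simp add: powr_times_real_left)
      thus ?thesis
        by (simp add: A_def B_def mult_ac)
    qed
    thus "(\<Sum>d | d dvd n. A d * B (n div d)) =
            (\<Sum>d | d dvd n. a d * b (n div d)) * of_nat n powr (-s)"
      by (simp add: sum_distrib_right)
  qed
  also have "\<dots> \<longleftrightarrow> ((\<lambda>n. (\<Sum>d | d dvd n. a d * b (n div d)) * of_nat n powr (-s)) has_sum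
                         (suminf A * suminf B)) UNIV"
    by (rule sum_pos[symmetric]) simp
  finally show ?thesis
    unfolding A_def B_def by (rule has_sum_imp_sums)
qed

lemma summable_norm_dirichlet_bounded:
  fixes a :: "nat \<Rightarrow> complex"
  assumes "\<And>n. norm (a n) \<le> C" and "Re s > 1"
  shows "summable (\<lambda>n. norm (a n * of_nat n powr (-s)))"
proof (rule summable_comparison_test')
  show "summable (\<lambda>n. C * real n powr (- Re s))"
    using assms by (intro summable_mult) (simp add: summable_real_powr_iff)
  show "norm (norm (a n * of_nat n powr (-s))) \<le> C * real n powr (- Re s)" for n
    using assms(1)[of n] by (auto simp: norm_mult intro!: mult_right_mono)
qed

text \<open>
  Half of the excess of \<open>Re s\<close> over \<open>1\<close> absorbs the logarithm.
\<close>

lemma summable_norm_dirichlet_ln: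
  fixes a :: "nat \<Rightarrow> complex"
  assumes "\<And>n. n > 0 \<Longrightarrow> norm (a n) \<le> ln n" and "Re s > 1"
  shows "summable (\<lambda>n. norm (a n * of_nat n powr (-s)))"
proof (rule summable_comparison_test')
  define e where "e = (Re s - 1) / 2"
  have e: "e > 0" using assms by (simp add: e_def)
  show "summable (\<lambda>n. (1 / e) * real n powr (e - Re s))"
    using assms by (intro summable_mult) (simp add: summable_real_powr_iff e_def field_simps)
  show "norm (norm (a n * of_nat n powr (-s))) \<le> (1 / e) * real n powr (e - Re s)" for n
  proof (cases "n = 0")
    case False
    have "norm (a n) * real n powr (- Re s) \<le> (real n powr e / e) * real n powr (- Re s)"
      using assms(1)[of n] ln_powr_bound[of "real n" e] False e by (intro mult_right_mono) auto
    also have "\<dots> = (1 / e) * real n powr (e - Re s)"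
      using False by (simp add: powr_diff powr_minus field_simps)
    finally show ?thesis by (simp add: norm_mult)
  qed auto
qed

lemma summable_norm_powr:
  "Re s > 1 \<Longrightarrow> summable (\<lambda>n. norm ((of_nat n :: complex) powr (-s)))"
  by (simp add: summable_real_powr_iff)

definition zeta_series :: "complex \<Rightarrow> complex" where
  "zeta_series s = (\<Sum>n. of_nat n powr (-s))"

lemma dirichlet_series_moebius:
  assumes s: "Re s > 1"
  shows "(\<Sum>n. of_int (moebius_mu n) * of_nat n powr (-s)) * zeta_series s = 1"
proof -
  have "(\<lambda>n. (\<Sum>d | d dvd n. of_int (moebius_mu d) * 1) * of_nat n powr (-s)) sums
          ((\<Sum>n. of_int (moebius_mu n) * of_nat n powr (-s)) * (\<Sum>n. 1 * of_nat n powr (-s)) :: complex)"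
    using norm_moebius_mu_le_1 s by (intro dirichlet_series_mult summable_norm_dirichlet_bounded[of _ 1]) auto
  moreover have "(\<Sum>d | d dvd n. of_int (moebius_mu d) * 1) * of_nat n powr (-s) =
                   (if n = 1 then 1 else 0 :: complex)" for n
  proof (cases "n = 0")
    case False
    have "(\<Sum>d | d dvd n. of_int (moebius_mu d) * 1) = (of_int (\<Sum>d | d dvd n. moebius_mu d) :: complex)"
      by simp
    with False show ?thesis
      by (subst (asm) sum_moebius_mu_divisors) auto
  qed auto
  ultimately show ?thesis
    using sums_single[of 1 "\<lambda>_. 1::complex"] sums_unique2 unfolding zeta_series_def by fastforce
qed

lemma zeta_series_nonzero: "Re s > 1 \<Longrightarrow> zeta_series s \<noteq> 0"
  using dirichlet_series_moebius[of s] by auto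

text \<open>
  On the disc of radius \<open>(Re s - 1) / 2\<close> around \<open>s\<close> the series is dominated by a convergent one,
  hence it may be differentiated term by term.
\<close>

lemma zeta_series_has_field_derivative:
  assumes s: "Re s > 1"
  shows "(zeta_series has_field_derivative
           (\<Sum>n. - of_real (ln (real n)) * of_nat n powr (-s))) (at s)"
proof -
  let ?S = "{s. Re s > 1}"
  have "\<exists>g g'. \<forall>x\<in>?S. (\<lambda>n. of_nat n powr (-x)) sums g x \<and>
          (\<lambda>n. - of_real (ln (real n)) * of_nat n powr (-x)) sums g' x \<and>
          (g has_field_derivative g' x) (at x)"
  proof (rule series_and_derivative_comparison_complex)
    show "open ?S"
      by (rule open_halfspace_Re_gt)
  next
    fix n and x :: complex
    show "((\<lambda>x. of_nat n powr (-x)) has_field_derivative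
            (- of_real (ln (real n)) * of_nat n powr (-x))) (at x)"
    proof (cases "n = 0")
      case False
      have "((\<lambda>x. of_nat n powr (-x)) has_field_derivative Ln (of_nat n) * of_nat n powr (-x) * (-1)) (at x)"
        using False by (intro DERIV_chain2[OF has_field_derivative_powr_right]) (auto intro!: derivative_eq_intros)
      moreover have "Ln (of_nat n) = of_real (ln (real n))"
        using False Ln_of_real[of "real n"] by simp
      ultimately show ?thesis
        by simp
    qed simp
  next
    fix x :: complex assume x: "x \<in> ?S"
    define d where "d = (Re x - 1) / 2"
    have d: "d > 0" using x by (simp add: d_def)
    have "summable (\<lambda>n. real n powr (-1-d))"
      using d by (simp add: summable_real_powr_iff)
    hence "summable (\<lambda>n. complex_of_real (real n powr (-1-d)))"
      by (rule summable_of_real)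
    moreover have "norm (of_nat n powr (-y) :: complex) \<le> norm (complex_of_real (real n powr (-1-d)))"
      if y: "y \<in> ball x d \<inter> ?S" for n y
    proof (cases "n = 0")
      case False
      have "Re x - Re y \<le> norm (x - y)"
        using complex_Re_le_cmod[of "x - y"] by simp
      with y have "Re y \<ge> 1 + d"
        by (auto simp: dist_norm d_def field_simps)
      thus ?thesis using False by (auto intro!: powr_mono)
    qed auto
    ultimately show "\<exists>d h. 0 < d \<and> summable h \<and> range h \<subseteq> \<real>\<^sub>\<ge>\<^sub>0 \<and>
        (\<forall>\<^sub>F n in sequentially. \<forall>y\<in>ball x d \<inter> ?S. norm (of_nat n powr (-y) :: complex) \<le> norm (h n :: complex))"
      using d by (intro exI[of _ d] exI[of _ "\<lambda>n. of_real (real n powr (-1-d))"]) auto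
  qed
  then obtain g g' where g: "\<And>x. x \<in> ?S \<Longrightarrow> (\<lambda>n. of_nat n powr (-x)) sums g x"
       "\<And>x. x \<in> ?S \<Longrightarrow> (\<lambda>n. - of_real (ln (real n)) * of_nat n powr (-x)) sums g' x"
       "\<And>x. x \<in> ?S \<Longrightarrow> (g has_field_derivative g' x) (at x)"
    by blast
  have "zeta_series x = g x" if "x \<in> ?S" for x
    using g(1)[OF that] by (simp add: zeta_series_def sums_unique[symmetric])
  hence "(zeta_series has_field_derivative g' s) (at s)"
    using g(3)[of s] s open_halfspace_Re_gt[of 1]
    by (auto intro: has_field_derivative_transform_within_open[of g])
  also have "g' s = (\<Sum>n. - of_real (ln (real n)) * of_nat n powr (-s))"
    using g(2)[of s] s by (simp add: sums_unique)
  finally show ?thesis .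
qed

definition mangoldt_series :: "complex \<Rightarrow> complex" where
  "mangoldt_series s = (\<Sum>n. mangoldt n * of_nat n powr (-s))"

lemma summable_norm_mangoldt:
  "Re s > 1 \<Longrightarrow> summable (\<lambda>n. norm (mangoldt n * of_nat n powr (-s) :: complex))"
  using summable_norm_dirichlet_ln[of mangoldt s] by (simp add: mangoldt_le)

text \<open>
  The identity \<open>-\<zeta>'/\<zeta> = \<Sum>\<Lambda>(n)/n\<^sup>s\<close>, which comes from \<open>\<Sum>d dvd n. \<Lambda>(d) = ln n\<close>.
\<close>

lemma deriv_zeta_series:
  assumes s: "Re s > 1"
  shows "(zeta_series has_field_derivative (- (mangoldt_series s * zeta_series s))) (at s)"
proof -
  have "(\<lambda>n. (\<Sum>d | d dvd n. mangoldt d * 1) * of_nat n powr (-s)) sums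
          ((\<Sum>n. mangoldt n * of_nat n powr (-s)) * (\<Sum>n. 1 * of_nat n powr (-s)) :: complex)"
    using s by (intro dirichlet_series_mult) (simp_all add: summable_norm_mangoldt summable_real_powr_iff del: norm_mult)
  moreover have "(\<Sum>d | d dvd n. mangoldt d * 1) * of_nat n powr (-s) =
                   of_real (ln (real n)) * of_nat n powr (-s :: complex)" for n
    by (cases "n = 0") (simp_all add: mangoldt_sum)
  ultimately have "(\<lambda>n. of_real (ln (real n)) * of_nat n powr (-s)) sums (mangoldt_series s * zeta_series s)"
    by (simp only: mangoldt_series_def zeta_series_def mult_1_left)
  from sums_minus[OF this] show ?thesis
    using zeta_series_has_field_derivative[OF s] by (simp add: sums_unique[symmetric])
qed


section \<open>Continuation of the zeta function to the right half-plane\<close>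

text \<open>
  Comparing \<open>n\<^bsup>-s\<^esup>\<close> with the integral of \<open>u\<^bsup>-s\<^esup>\<close> over \<open>[n, n+1]\<close> isolates the pole of the zeta
  function. After multiplication by \<open>s - 1\<close> the integral becomes \<open>n\<^bsup>1-s\<^esup> - (n+1)\<^bsup>1-s\<^esup>\<close>, whose sum
  telescopes to \<open>1\<close>, and \<open>zeta_reg s\<close> is \<open>(s - 1) \<zeta>(s)\<close>.
\<close>

definition zeta_term :: "nat \<Rightarrow> complex \<Rightarrow> complex" where
  "zeta_term n s = (s - 1) * of_nat (Suc n) powr (-s) +
     of_nat (Suc (Suc n)) powr (1 - s) - of_nat (Suc n) powr (1 - s)"

definition zeta_reg :: "complex \<Rightarrow> complex" where
  "zeta_reg s = 1 + (\<Sum>n. zeta_term n s)"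

text \<open>
  The term is the error of the linear approximation to \<open>z\<^bsup>1-s\<^esup>\<close> at \<open>z = n\<close> on a segment of
  length \<open>1\<close>. Two applications of the mean value inequality bound it by the second derivative.
\<close>

lemma norm_zeta_term_le:
  assumes s: "Re s > 0"
  shows "norm (zeta_term n s) \<le> norm s * norm (s - 1) * real (Suc n) powr (-1 - Re s)"
proof -
  define a b :: real where "a = real (Suc n)" and "b = real (Suc (Suc n))"
  have ab: "a > 0" "b = a + 1" by (simp_all add: a_def b_def)
  define S where "S = closed_segment (complex_of_real a) (complex_of_real b)"
  have S: "\<exists>u. z = of_real u \<and> a \<le> u \<and> u \<le> b" if "z \<in> S" for z
    using that ab unfolding S_def closed_segment_of_real closed_segment_eq_real_ivl by auto
  have endpts: "of_real a \<in> S" "of_real b \<in> S" "convex S"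
    by (simp_all add: S_def)
  have pos: "z \<notin> \<real>\<^sub>\<le>\<^sub>0" if "z \<in> S" for z
    using S[OF that] ab by auto
  define B where "B = norm s * a powr (-1 - Re s)"
  have 1: "norm (z powr (-s) - of_real a powr (-s)) \<le> B" if z: "z \<in> S" for z
  proof -
    have "norm (z powr (-s) - of_real a powr (-s)) \<le> B * norm (z - of_real a)"
    proof (rule field_differentiable_bound[OF endpts(3) _ _ z endpts(1)])
      fix w assume w: "w \<in> S"
      show "((\<lambda>w. w powr (-s)) has_field_derivative (- s * w powr (- s - 1))) (at w within S)"
        using pos[OF w] by (intro has_field_derivative_at_within[OF has_field_derivative_powr])
      obtain u where u: "w = of_real u" "a \<le> u"
        using S[OF w] by auto
      have "norm (w powr (- s - 1)) = u powr (Re (- s - 1))"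
        using u ab by (simp add: norm_powr_real_powr)
      also have "Re (- s - 1) = -1 - Re s"
        by simp
      also have "u powr (-1 - Re s) \<le> a powr (-1 - Re s)"
        using u ab s by (intro powr_mono2') auto
      finally show "norm (- s * w powr (- s - 1)) \<le> B"
        by (simp add: B_def norm_mult mult_left_mono)
    qed
    also obtain u where "z = of_real u" "a \<le> u" "u \<le> a + 1"
      using S[OF z] ab by auto
    hence "norm (z - of_real a) \<le> 1"
      by (auto simp flip: of_real_diff)
    hence "B * norm (z - of_real a) \<le> B * 1"
      by (intro mult_left_mono) (auto simp: B_def)
    finally show ?thesis by simp
  qed
  \<comment> \<open>The derivative of \<open>f\<close> is \<open>1 - s\<close> times the difference just estimated.\<close>
  define f where "f = (\<lambda>z. z powr (1 - s) - (1 - s) * of_real a powr (-s) * z)"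
  have "norm (f (of_real b) - f (of_real a)) \<le> norm (1 - s) * B * norm (complex_of_real b - of_real a)"
  proof (rule field_differentiable_bound[OF endpts(3) _ _ endpts(2,1)])
    fix w assume w: "w \<in> S"
    have "((\<lambda>w. w powr (1-s)) has_field_derivative ((1 - s) * w powr (1 - s - 1))) (at w within S)"
      using pos[OF w] by (intro has_field_derivative_at_within[OF has_field_derivative_powr])
    thus "(f has_field_derivative ((1 - s) * (w powr (-s) - of_real a powr (-s)))) (at w within S)"
      unfolding f_def right_diff_distrib using pos[OF w]
      by (auto intro!: derivative_eq_intros simp: algebra_simps)
    show "norm ((1 - s) * (w powr (-s) - of_real a powr (-s))) \<le> norm (1 - s) * B"
      using 1[OF w] by (auto simp: norm_mult intro!: mult_left_mono)
  qed
  also have "f (of_real b) - f (of_real a) = zeta_term n s"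
    using ab(2) by (simp add: f_def zeta_term_def a_def b_def algebra_simps)
  also have "norm (1 - s) * B * norm (complex_of_real b - of_real a) =
               norm s * norm (s - 1) * real (Suc n) powr (-1 - Re s)"
    using ab(2) by (simp add: B_def a_def norm_minus_commute)
  finally show ?thesis .
qed

lemma holomorphic_zeta_reg: "zeta_reg holomorphic_on {s. Re s > 0}"
proof -
  let ?S = "{s. Re s > 0}"
  have op: "open ?S" by (rule open_halfspace_Re_gt)
  obtain g where g: "\<forall>x\<in>?S. (\<lambda>n. zeta_term n x) sums g x \<and> g field_differentiable (at x)"
  proof (rule series_differentiable_comparison_complex[OF op])
    fix n and x :: complex
    have "zeta_term n holomorphic_on UNIV"
      unfolding zeta_term_def by (intro holomorphic_intros) (auto simp del: of_nat_Suc)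
    thus "zeta_term n field_differentiable (at x)"
      by (simp add: holomorphic_on_def)
  next
    fix x assume x: "x \<in> ?S"
    define d where "d = Re x / 2"
    have d: "d > 0" using x by (simp add: d_def)
    define C where "C = (norm x + d) * (norm x + d + 1)"
    define h where "h n = C * real (Suc n) powr (-1 - d)" for n
    have "summable (\<lambda>n. real n powr (-1 - d))"
      using d by (simp add: summable_real_powr_iff)
    hence "summable h"
      unfolding h_def by (intro summable_mult) (subst summable_Suc_iff)
    hence "summable (\<lambda>n. complex_of_real (h n))"
      by (rule summable_of_real)
    moreover have "h n \<ge> 0" for n
      using d by (simp add: h_def C_def)
    moreover have "norm (zeta_term n y) \<le> norm (complex_of_real (h n))" if y: "y \<in> ball x d \<inter> ?S" for n y
    proof -
      have "Re x - Re y \<le> norm (x - y)"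
        using complex_Re_le_cmod[of "x - y"] by simp
      with y have 1: "Re y \<ge> d"
        by (auto simp: dist_norm d_def field_simps)
      have 2: "norm y \<le> norm x + d"
        using y norm_triangle_sub[of y x] by (auto simp: dist_norm norm_minus_commute)
      have 3: "norm (y - 1) \<le> norm x + d + 1"
        using 2 norm_triangle_ineq4[of y 1] by simp
      have "norm (zeta_term n y) \<le> norm y * norm (y - 1) * real (Suc n) powr (-1 - Re y)"
        using y by (intro norm_zeta_term_le) auto
      also have "\<dots> \<le> C * real (Suc n) powr (-1 - d)"
        unfolding C_def using 1 2 3 d by (intro mult_mono powr_mono) auto
      also have "\<dots> = norm (complex_of_real (h n))"
        using \<open>h n \<ge> 0\<close> by (simp only: h_def [symmetric] norm_of_real abs_of_nonneg)
      finally show ?thesis .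
    qed
    ultimately show "\<exists>d h. 0 < d \<and> summable h \<and> range h \<subseteq> \<real>\<^sub>\<ge>\<^sub>0 \<and>
        (\<forall>\<^sub>F n in sequentially. \<forall>y\<in>ball x d \<inter> ?S. norm (zeta_term n y) \<le> norm (h n :: complex))"
      using d by (intro exI[of _ d] exI[of _ "\<lambda>n. of_real (h n)"]) auto
  qed
  have "g holomorphic_on ?S"
    using g op by (simp add: holomorphic_on_open field_differentiable_def)
  hence "(\<lambda>s. 1 + g s) holomorphic_on ?S"
    by (intro holomorphic_intros)
  also have "?this \<longleftrightarrow> zeta_reg holomorphic_on ?S"
    using g by (intro holomorphic_cong) (auto simp: zeta_reg_def sums_unique[symmetric])
  finally show ?thesis .
qed

lemma zeta_reg_1: "zeta_reg 1 = 1"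
  by (simp add: zeta_reg_def zeta_term_def del: of_nat_Suc)

lemma zeta_reg_eq_zeta_series:
  assumes s: "Re s > 1"
  shows "zeta_reg s = (s - 1) * zeta_series s"
proof -
  have "(\<lambda>n. (of_nat n :: complex) powr (-s)) sums zeta_series s"
    unfolding zeta_series_def using s by (intro summable_sums summable_norm_cancel[OF summable_norm_powr])
  hence 1: "(\<lambda>n. (of_nat (Suc n) :: complex) powr (-s)) sums zeta_series s"
    by (subst sums_Suc_iff) simp
  have "(\<lambda>n. (of_nat n :: complex) powr (1 - s)) \<longlonglongrightarrow> 0"
    using s by (intro tendsto_neg_powr_complex_of_nat filterlim_ident) auto
  hence "(\<lambda>n. (of_nat (Suc n) :: complex) powr (1 - s)) \<longlonglongrightarrow> 0"
    by (rule LIMSEQ_Suc)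
  from telescope_sums[OF this]
  have 2: "(\<lambda>n. (of_nat (Suc (Suc n)) :: complex) powr (1 - s) - of_nat (Suc n) powr (1 - s)) sums (0 - 1)"
    by simp
  have "(\<lambda>n. zeta_term n s) sums ((s - 1) * zeta_series s + (0 - 1))"
    using sums_add[OF sums_mult[OF 1, of "s - 1"] 2] by (simp add: zeta_term_def add_diff_eq)
  thus ?thesis
    by (simp add: zeta_reg_def sums_unique[symmetric])
qed

lemma zeta_reg_log_deriv:
  assumes s: "Re s > 1"
  shows "deriv zeta_reg s / zeta_reg s = 1 / (s - 1) - mangoldt_series s"
proof -
  have "((\<lambda>s. (s - 1) * zeta_series s) has_field_derivative
          (zeta_series s - (s - 1) * (mangoldt_series s * zeta_series s))) (at s)"
    using deriv_zeta_series[OF s] by (auto intro!: derivative_eq_intros)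
  hence "(zeta_reg has_field_derivative
          (zeta_series s - (s - 1) * (mangoldt_series s * zeta_series s))) (at s)"
    by (rule has_field_derivative_transform_within_open[where S = "{s. Re s > 1}"])
       (use s in \<open>auto simp: zeta_reg_eq_zeta_series open_halfspace_Re_gt\<close>)
  hence "deriv zeta_reg s = zeta_series s - (s - 1) * (mangoldt_series s * zeta_series s)"
    by (rule DERIV_imp_deriv)
  moreover from s have "s \<noteq> 1" and "zeta_series s \<noteq> 0"
    using zeta_series_nonzero by auto
  moreover have "zeta_series s - (s - 1) * (mangoldt_series s * zeta_series s) =
      (1 / (s - 1) - mangoldt_series s) * ((s - 1) * zeta_series s)"
  proof -
    have "(1 / (s - 1) - mangoldt_series s) * ((s - 1) * zeta_series s) =
            1 / (s - 1) * ((s - 1) * zeta_series s) - mangoldt_series s * ((s - 1) * zeta_series s)"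
      by (rule left_diff_distrib)
    also have "1 / (s - 1) * ((s - 1) * zeta_series s) = zeta_series s"
      using \<open>s \<noteq> 1\<close> by simp
    also have "mangoldt_series s * ((s - 1) * zeta_series s) = (s - 1) * (mangoldt_series s * zeta_series s)"
      by (simp only: mult_ac)
    finally show ?thesis ..
  qed
  ultimately show ?thesis
    by (simp add: zeta_reg_eq_zeta_series s)
qed

section \<open>Nonvanishing on the line of real part one\<close>

text \<open>
  With \<open>w = n\<^bsup>-it\<^esup>\<close>, of absolute value \<open>1\<close>, each term is a nonnegative multiple of
  \<open>Re (3 + 4 w + w\<^sup>2) = 2 (1 + Re w)\<^sup>2\<close>.
\<close>

lemma mangoldt_series_3_4_1:
  assumes "\<sigma> > 1"
  shows "Re (3 * mangoldt_series (of_real \<sigma>) + 4 * mangoldt_series (of_real \<sigma> + \<i> * of_real t)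
           + mangoldt_series (of_real \<sigma> + \<i> * of_real (2 * t))) \<ge> 0"
proof -
  have L: "(\<lambda>n. mangoldt n * of_nat n powr (-s)) sums mangoldt_series s" if "Re s > 1" for s :: complex
    unfolding mangoldt_series_def
    using that by (intro summable_sums summable_norm_cancel[OF summable_norm_mangoldt])
  define F where "F n = 3 * (mangoldt n * of_nat n powr (- of_real \<sigma>))
      + 4 * (mangoldt n * of_nat n powr (-(of_real \<sigma> + \<i> * of_real t)))
      + mangoldt n * of_nat n powr (-(of_real \<sigma> + \<i> * of_real (2 * t)))" for n :: nat
  have "F sums (3 * mangoldt_series (of_real \<sigma>) + 4 * mangoldt_series (of_real \<sigma> + \<i> * of_real t)
           + mangoldt_series (of_real \<sigma> + \<i> * of_real (2 * t)))"
    unfolding F_def by (intro sums_add sums_mult L) (use assms in auto)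
  hence "(\<lambda>n. Re (F n)) sums Re (3 * mangoldt_series (of_real \<sigma>) + 4 * mangoldt_series (of_real \<sigma> + \<i> * of_real t)
           + mangoldt_series (of_real \<sigma> + \<i> * of_real (2 * t)))"
    by (rule sums_Re)
  moreover have "Re (F n) \<ge> 0" for n
  proof (cases "n = 0")
    case False
    define w where "w = (of_nat n :: complex) powr (-(\<i> * of_real t))"
    have w: "norm w = 1"
      using False by (simp add: w_def)
    have "(of_nat n :: complex) powr (-(of_real \<sigma> + \<i> * of_real t)) = of_nat n powr (-of_real \<sigma>) * w"
      unfolding w_def by (simp flip: powr_add)
    moreover have "(of_nat n :: complex) powr (-(of_real \<sigma> + \<i> * of_real (2 * t))) = of_nat n powr (-of_real \<sigma>) * w ^ 2"
      unfolding w_def power2_eq_square by (simp flip: powr_add add: algebra_simps)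
    moreover have "(of_nat n :: complex) powr (-of_real \<sigma>) = of_real (real n powr (-\<sigma>))"
      by (subst powr_of_real[symmetric]) auto
    moreover have "mangoldt n = complex_of_real (mangoldt n)"
      by simp
    ultimately have "F n = of_real (mangoldt n * real n powr (-\<sigma>)) * (3 + 4 * w + w ^ 2)"
      unfolding F_def by (simp add: algebra_simps)
    hence "Re (F n) = mangoldt n * real n powr (-\<sigma>) * Re (3 + 4 * w + w ^ 2)"
      by simp
    moreover have "(Re w)\<^sup>2 + (Im w)\<^sup>2 = 1"
      using w by (simp add: cmod_def)
    hence "Re (3 + 4 * w + w ^ 2) = 2 * (1 + Re w)\<^sup>2"
      by (simp add: power2_eq_square algebra_simps)
    ultimately show ?thesis
      by (simp add: mangoldt_nonneg)
  qed (auto simp: F_def)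
  ultimately show ?thesis
    by (rule sums_le[OF _ sums_zero, rotated])
qed

text \<open>
  The residue of the logarithmic derivative is the order of vanishing: factor out the zero of
  order \<open>m\<close> and differentiate \<open>f(x) = (x - z)\<^bsup>m\<^esup> g(x)\<close>.
\<close>

lemma log_deriv_order:
  assumes f: "f holomorphic_on S" and S: "open S" "connected S" and z: "z \<in> S"
    and w: "w \<in> S" "f w \<noteq> 0"
  obtains m :: nat where "((\<lambda>x. (x - z) * (deriv f x / f x)) \<longlongrightarrow> of_nat m) (at z)"
    and "m > 0 \<longleftrightarrow> f z = 0"
proof (cases "f z = 0")
  case False
  have "isCont f z" "isCont (deriv f) z"
    using holomorphic_on_imp_continuous_on[OF f] holomorphic_on_imp_continuous_on[OF holomorphic_deriv[OF f S(1)]]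
      S z by (simp_all add: continuous_on_eq_continuous_at)
  hence "((\<lambda>x. (x - z) * (deriv f x / f x)) \<longlongrightarrow> (z - z) * (deriv f z / f z)) (at z)"
    using False by (intro tendsto_intros) (auto simp: isCont_def)
  thus ?thesis
    using that[of 0] False by simp
next
  case True
  have "\<not> f constant_on S"
    using True z w unfolding constant_on_def by metis
  then obtain g r m where m: "0 < m" "0 < r" "ball z r \<subseteq> S" "g holomorphic_on ball z r"
      "\<And>w. w \<in> ball z r \<Longrightarrow> f w = (w - z) ^ m * g w" "\<And>w. w \<in> ball z r \<Longrightarrow> g w \<noteq> 0"
    using holomorphic_factor_zero_nonconstant[OF f S z True] by metis
  have zb: "z \<in> ball z r" using m by simp
  have "isCont g z" "isCont (deriv g) z"
    using holomorphic_on_imp_continuous_on[OF m(4)]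
      holomorphic_on_imp_continuous_on[OF holomorphic_deriv[OF m(4) open_ball]] zb
    by (simp_all add: continuous_on_eq_continuous_at)
  hence "((\<lambda>x. of_nat m + (x - z) * (deriv g x / g x)) \<longlongrightarrow> of_nat m + (z - z) * (deriv g z / g z)) (at z)"
    using m(6)[OF zb] by (intro tendsto_intros) (auto simp: isCont_def)
  moreover have "\<forall>\<^sub>F x in at z. of_nat m + (x - z) * (deriv g x / g x) = (x - z) * (deriv f x / f x)"
    using eventually_at_ball[OF m(2), of z UNIV] eventually_neq_at_within[of z z]
  proof eventually_elim
    case (elim x)
    hence x: "x \<in> ball z r" "x \<noteq> z" by auto
    have "(g has_field_derivative deriv g x) (at x)"
      using m(4) x by (intro holomorphic_derivI[of _ "ball z r"]) auto
    hence "((\<lambda>x. (x - z) ^ m * g x) has_field_derivative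
             (of_nat m * (x - z) ^ (m - 1) * g x + (x - z) ^ m * deriv g x)) (at x)"
      by (auto intro!: derivative_eq_intros)
    hence "(f has_field_derivative
             (of_nat m * (x - z) ^ (m - 1) * g x + (x - z) ^ m * deriv g x)) (at x)"
      by (rule has_field_derivative_transform_within_open[where S = "ball z r"]) (use x m in auto)
    hence "deriv f x = of_nat m * (x - z) ^ (m - 1) * g x + (x - z) ^ m * deriv g x"
      by (rule DERIV_imp_deriv)
    moreover have "(x - z) ^ m = (x - z) * (x - z) ^ (m - 1)"
      using m(1) by (cases m) simp_all
    ultimately have "(x - z) * deriv f x = (x - z) ^ m * (of_nat m * g x + (x - z) * deriv g x)"
      by (simp only: distrib_left mult_ac)
    hence "(x - z) * (deriv f x / f x) =
             (x - z) ^ m * (of_nat m * g x + (x - z) * deriv g x) / ((x - z) ^ m * g x)"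
      using m(5)[OF x(1)] by (simp only: times_divide_eq_right)
    also have "\<dots> = (of_nat m * g x + (x - z) * deriv g x) / g x"
      using x(2) by simp
    also have "\<dots> = of_nat m + (x - z) * (deriv g x / g x)"
      using m(6)[OF x(1)] by (simp add: add_divide_distrib)
    finally show ?case ..
  qed
  ultimately have "((\<lambda>x. (x - z) * (deriv f x / f x)) \<longlongrightarrow> of_nat m) (at z)"
    using Lim_transform_eventually by fastforce
  thus ?thesis
    using that[of m] m True by simp
qed

text \<open>
  Since \<open>\<Sum>\<Lambda>(n)/n\<^sup>s = 1/(s-1) - f'(s)/f(s)\<close> for \<open>f = zeta_reg\<close>, the growth of this series near
  \<open>1 + i y\<close> detects the zeros of \<open>f\<close>: a zero of order \<open>m\<close> contributes \<open>-m\<close>, and only \<open>y = 0\<close> receives a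
  contribution \<open>1\<close> from the pole.
\<close>

lemma mangoldt_series_pole_order:
  fixes y :: real
  obtains m :: nat where
    "((\<lambda>\<sigma>. of_real (\<sigma> - 1) * mangoldt_series (of_real \<sigma> + \<i> * of_real y)) \<longlongrightarrow>
        of_bool (y = 0) - of_nat m) (at_right 1)"
    and "m > 0 \<longleftrightarrow> zeta_reg (1 + \<i> * of_real y) = 0"
proof -
  let ?z = "1 + \<i> * of_real y :: complex"
  let ?s = "\<lambda>\<sigma>::real. of_real \<sigma> + \<i> * of_real y :: complex"
  obtain m where m: "((\<lambda>x. (x - ?z) * (deriv zeta_reg x / zeta_reg x)) \<longlongrightarrow> of_nat m) (at ?z)"
      "m > 0 \<longleftrightarrow> zeta_reg ?z = 0"
    by (rule log_deriv_order[of zeta_reg "{s. Re s > 0}" ?z 1])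
       (auto simp: holomorphic_zeta_reg open_halfspace_Re_gt zeta_reg_1
          convex_connected convex_halfspace_Re_gt)
  have "(?s \<longlongrightarrow> of_real 1 + \<i> * of_real y) (at_right 1)"
    by (intro tendsto_intros)
  moreover have "\<forall>\<^sub>F \<sigma> in at_right 1. ?s \<sigma> \<noteq> ?z"
    using eventually_at_right_less[of "1::real"] by eventually_elim (simp add: complex_eq_iff)
  ultimately have "filterlim ?s (at ?z) (at_right 1)"
    by (simp add: filterlim_at)
  from filterlim_compose[OF m(1) this]
  have 1: "((\<lambda>\<sigma>. of_real (\<sigma> - 1) * (deriv zeta_reg (?s \<sigma>) / zeta_reg (?s \<sigma>))) \<longlongrightarrow> of_nat m) (at_right 1)"
    by simp
  have 2: "((\<lambda>\<sigma>. of_real (\<sigma> - 1) / (?s \<sigma> - 1)) \<longlongrightarrow> of_bool (y = 0)) (at_right 1)"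
  proof (cases "y = 0")
    case True
    have "\<forall>\<^sub>F \<sigma>::real in at_right 1. 1 = of_real (\<sigma> - 1) / (?s \<sigma> - 1)"
      using eventually_at_right_less[of "1::real"] by eventually_elim (use True in auto)
    from Lim_transform_eventually[OF tendsto_const this] True show ?thesis
      by simp
  next
    case False
    have "((\<lambda>\<sigma>. of_real (\<sigma> - 1) / (?s \<sigma> - 1)) \<longlongrightarrow> of_real (1 - 1) / (of_real 1 + \<i> * of_real y - 1)) (at_right 1)"
      using False by (intro tendsto_intros) auto
    with False show ?thesis by simp
  qed
  have "\<forall>\<^sub>F \<sigma> in at_right 1. of_real (\<sigma> - 1) / (?s \<sigma> - 1) -
         of_real (\<sigma> - 1) * (deriv zeta_reg (?s \<sigma>) / zeta_reg (?s \<sigma>))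
         = of_real (\<sigma> - 1) * mangoldt_series (?s \<sigma>)"
    using eventually_at_right_less[of "1::real"]
  proof eventually_elim
    case (elim \<sigma>)
    have "deriv zeta_reg (?s \<sigma>) / zeta_reg (?s \<sigma>) = 1 / (?s \<sigma> - 1) - mangoldt_series (?s \<sigma>)"
      using elim by (intro zeta_reg_log_deriv) auto
    thus ?case
      by (simp only: right_diff_distrib) simp
  qed
  from Lim_transform_eventually[OF tendsto_diff[OF 2 1] this] m(2) show ?thesis
    by (rule that)
qed

text \<open>
  Multiply the inequality \<open>mangoldt_series_3_4_1\<close> by \<open>\<sigma> - 1\<close> and let \<open>\<sigma>\<close> tend to \<open>1\<close>. If \<open>m\<^sub>1\<close>, \<open>m\<^sub>2\<close> are
  the orders of vanishing at \<open>1 + i t\<close> and \<open>1 + 2 i t\<close>, this gives \<open>3 - 4 m\<^sub>1 - m\<^sub>2 \<ge> 0\<close>, so \<open>m\<^sub>1 = 0\<close>.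
\<close>

theorem zeta_reg_nonzero:
  assumes "Re s \<ge> 1"
  shows "zeta_reg s \<noteq> 0"
proof (cases "Re s > 1")
  case True
  thus ?thesis
    using zeta_series_nonzero[of s] by (auto simp: zeta_reg_eq_zeta_series)
next
  case False
  define t where "t = Im s"
  have s: "s = 1 + \<i> * of_real t"
    using assms False by (simp add: complex_eq_iff t_def)
  show ?thesis
  proof (cases "t = 0")
    case True
    thus ?thesis by (simp add: s zeta_reg_1)
  next
    case t: False
    let ?L = "\<lambda>y \<sigma>. of_real (\<sigma> - 1) * mangoldt_series (of_real \<sigma> + \<i> * of_real y)"
    obtain m0 where m0: "(?L 0 \<longlongrightarrow> of_bool ((0::real) = 0) - of_nat m0) (at_right 1)"
        "m0 > 0 \<longleftrightarrow> zeta_reg (1 + \<i> * of_real 0) = 0"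
      by (rule mangoldt_series_pole_order)
    obtain m1 where m1: "(?L t \<longlongrightarrow> of_bool (t = 0) - of_nat m1) (at_right 1)"
        "m1 > 0 \<longleftrightarrow> zeta_reg (1 + \<i> * of_real t) = 0"
      by (rule mangoldt_series_pole_order)
    obtain m2 where m2: "(?L (2 * t) \<longlongrightarrow> of_bool (2 * t = 0) - of_nat m2) (at_right 1)"
      by (rule mangoldt_series_pole_order)
    have "m0 = 0"
      using m0(2) by (simp add: zeta_reg_1)
    have "((\<lambda>\<sigma>. Re (3 * ?L 0 \<sigma> + 4 * ?L t \<sigma> + ?L (2 * t) \<sigma>)) \<longlongrightarrow>
             Re (3 * (of_bool ((0::real) = 0) - of_nat m0) + 4 * (of_bool (t = 0) - of_nat m1) +
               (of_bool (2 * t = 0) - of_nat m2))) (at_right 1)"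
      by (intro tendsto_Re tendsto_add tendsto_mult[OF tendsto_const] m0(1) m1(1) m2(1))
    moreover have "\<forall>\<^sub>F \<sigma>::real in at_right 1. Re (3 * ?L 0 \<sigma> + 4 * ?L t \<sigma> + ?L (2 * t) \<sigma>) \<ge> 0"
      using eventually_at_right_less[of "1::real"]
    proof eventually_elim
      case (elim \<sigma>)
      define X where "X = 3 * mangoldt_series (of_real \<sigma>) + 4 * mangoldt_series (of_real \<sigma> + \<i> * of_real t)
           + mangoldt_series (of_real \<sigma> + \<i> * of_real (2 * t))"
      have "3 * ?L 0 \<sigma> + 4 * ?L t \<sigma> + ?L (2 * t) \<sigma> = of_real (\<sigma> - 1) * X"
        unfolding X_def by (simp only: distrib_left mult_ac) simp
      moreover have "Re X \<ge> 0"
        unfolding X_def by (rule mangoldt_series_3_4_1[OF elim])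
      ultimately show ?case
        using elim by (simp only: times_complex.sel Re_complex_of_real Im_complex_of_real) simp
    qed
    ultimately have "Re (3 * (of_bool ((0::real) = 0) - of_nat m0) + 4 * (of_bool (t = 0) - of_nat m1) +
               (of_bool (2 * t = 0) - of_nat m2)) \<ge> 0"
      by (rule tendsto_lowerbound) auto
    hence "m1 = 0"
      using t \<open>m0 = 0\<close> by simp
    thus ?thesis
      using m1(2) by (simp add: s)
  qed
qed

section \<open>A Tauberian theorem of Newman\<close>

lemma powr_nat_mvt:
  fixes x :: real
  assumes "n > 0"
  obtains c where "real n < c" "c < real (Suc n)"
    "real (Suc n) powr x - real n powr x = x * c powr (x - 1)"
proof -
  have "\<exists>c. c > real n \<and> c < real (Suc n) \<and>
          real (Suc n) powr x - real n powr x = (real (Suc n) - real n) * (x * c powr (x - 1))"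
  proof (rule MVT2)
    fix c assume "real n \<le> c" "c \<le> real (Suc n)"
    thus "((\<lambda>c. c powr x) has_real_derivative x * c powr (x - 1)) (at c)"
      using assms by (intro has_real_derivative_powr) auto
  qed auto
  thus ?thesis
    using that by auto
qed

text \<open>
  Compare \<open>x n\<^bsup>x-1\<^esup>\<close>, the derivative of \<open>u\<^sup>x\<close> at \<open>u = n\<close>, with the increment of \<open>u\<^sup>x\<close> over \<open>[n, n+1]\<close> if
  \<open>x \<ge> 1\<close> and over \<open>[n-1, n]\<close> if \<open>x < 1\<close>, and sum.
\<close>

lemma sum_powr_le:
  fixes x :: real
  assumes "x > 0"
  shows "x * (\<Sum>n<N. real n powr (x - 1)) \<le> real N powr x"
proof (cases "x \<ge> 1")
  case True
  have "x * (\<Sum>n<N. real n powr (x - 1)) = (\<Sum>n<N. x * real n powr (x - 1))"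
    by (simp add: sum_distrib_left)
  also have "\<dots> \<le> (\<Sum>n<N. real (Suc n) powr x - real n powr x)"
  proof (rule sum_mono)
    fix n
    show "x * real n powr (x - 1) \<le> real (Suc n) powr x - real n powr x"
    proof (cases "n = 0")
      case False
      then obtain c where c: "real n < c" "real (Suc n) powr x - real n powr x = x * c powr (x - 1)"
        using powr_nat_mvt[of n x] by auto
      have "real n powr (x - 1) \<le> c powr (x - 1)"
        using c True by (intro powr_mono2) auto
      thus ?thesis using c assms by simp
    qed auto
  qed
  also have "\<dots> = real N powr x"
    by (subst sum_lessThan_telescope) (use assms in auto)
  finally show ?thesis .
next
  case False
  have le: "x * (\<Sum>n<Suc N. real n powr (x - 1)) \<le> real N powr x" for N
  proof (induction N)
    case (Suc N)
    have "x * real (Suc N) powr (x - 1) \<le> real (Suc N) powr x - real N powr x"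
    proof (cases "N = 0")
      case True
      thus ?thesis using False by simp
    next
      case N: False
      then obtain c where c: "real N < c" "c < real (Suc N)"
          "real (Suc N) powr x - real N powr x = x * c powr (x - 1)"
        using powr_nat_mvt[of N x] by auto
      have "real (Suc N) powr (x - 1) \<le> c powr (x - 1)"
        using c False N by (intro powr_mono2') auto
      thus ?thesis using c assms by simp
    qed
    moreover have "x * (\<Sum>n<Suc (Suc N). real n powr (x - 1)) =
        x * (\<Sum>n<Suc N. real n powr (x - 1)) + x * real (Suc N) powr (x - 1)"
      by (simp add: distrib_left)
    ultimately show ?case using Suc by linarith
  qed auto
  show ?thesis
  proof (cases N)
    case (Suc M)
    have "real M powr x \<le> real N powr x"
      using assms Suc by (intro powr_mono2) auto
    with le[of M] Suc show ?thesis by simp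
  qed auto
qed

text \<open>
  The terms after the first are bounded by the telescoping differences \<open>n\<^bsup>-x\<^esup> - (n+1)\<^bsup>-x\<^esup>\<close>; the first
  one accounts for \<open>x / N\<close>.
\<close>

lemma suminf_powr_tail_le:
  fixes x :: real
  assumes x: "x > 0" and N: "N > 0"
  shows "x * (\<Sum>n. real (n + N) powr (-1 - x)) \<le> real N powr (-x) * (1 + x / real N)"
proof -
  have sm: "summable (\<lambda>n. real (n + N) powr (-1 - x))"
    using x by (subst summable_iff_shift) (simp add: summable_real_powr_iff)
  have "(\<lambda>n. real n powr (-x)) \<longlonglongrightarrow> 0"
    using x by real_asymp
  hence "(\<lambda>n. real (n + N) powr (-x)) \<longlonglongrightarrow> 0"
    by (rule LIMSEQ_ignore_initial_segment)
  from telescope_sums'[OF this]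
  have tel: "(\<lambda>n. real (n + N) powr (-x) - real (Suc n + N) powr (-x)) sums (real N powr (-x))"
    by simp
  have le: "x * real (Suc n + N) powr (-1 - x) \<le> real (n + N) powr (-x) - real (Suc n + N) powr (-x)" for n
  proof -
    obtain c where c: "real (n + N) < c" "c < real (Suc (n + N))"
        "real (Suc (n + N)) powr (-x) - real (n + N) powr (-x) = -x * c powr (-x - 1)"
      using powr_nat_mvt[of "n + N" "-x"] N by auto
    have "real (Suc (n + N)) powr (-1 - x) \<le> c powr (-1 - x)"
      using c x N by (intro powr_mono2') auto
    hence "x * real (Suc (n + N)) powr (-1 - x) \<le> x * c powr (-1 - x)"
      using x by (intro mult_left_mono) auto
    moreover have "-x - 1 = -1 - x"
      by simp
    hence "real (Suc (n + N)) powr (-x) - real (n + N) powr (-x) = -x * c powr (-1 - x)"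
      using c(3) by (simp only:)
    ultimately show ?thesis by simp
  qed
  have sm': "summable (\<lambda>n. real (Suc n + N) powr (-1 - x))"
    using sm by (subst summable_Suc_iff)
  have "(\<Sum>n. x * real (Suc n + N) powr (-1 - x)) \<le>
          (\<Sum>n. real (n + N) powr (-x) - real (Suc n + N) powr (-x))"
    by (rule suminf_le[OF le]) (use sm' tel in \<open>auto intro: summable_mult sums_summable\<close>)
  hence "x * (\<Sum>n. real (Suc n + N) powr (-1 - x)) \<le> real N powr (-x)"
    using tel sm' by (simp only: sums_unique[symmetric] suminf_mult)
  moreover have "(\<Sum>n. real (n + N) powr (-1 - x)) = real N powr (-1 - x) + (\<Sum>n. real (Suc n + N) powr (-1 - x))"
    using suminf_split_head[OF sm] by simp
  moreover have "real N powr (-1 - x) = real N powr (-x) / real N"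
    using N powr_add[of "real N" "-1" "-x"] by (simp add: powr_minus divide_simps mult_ac)
  ultimately show ?thesis
    by (simp add: algebra_simps)
qed

lemma has_contour_integral_inverse_semicircle:
  assumes "R > 0"
  shows "((\<lambda>z. 1 / z) has_contour_integral \<i> * of_real pi) (part_circlepath 0 R (-pi/2) (pi/2))"
proof -
  have "((\<lambda>t. \<i>) has_integral (pi/2 - (-pi/2)) *\<^sub>R \<i>) {-pi/2..pi/2}"
    using has_integral_const_real[of \<i> "-pi/2" "pi/2"] by (simp add: scaleR_conv_of_real)
  also have "(pi/2 - (-pi/2)) *\<^sub>R \<i> = \<i> * of_real pi"
    by (simp add: scaleR_conv_of_real)
  finally show ?thesis
    using assms by (subst has_contour_integral_part_circlepath_iff) (auto simp: field_simps)
qed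

lemma semicircle_endpoints:
  "pathstart (part_circlepath 0 R (-pi/2) (pi/2)) = -\<i> * of_real R"
  "pathfinish (part_circlepath 0 R (-pi/2) (pi/2)) = \<i> * of_real R"
  by (simp_all only: pathstart_part_circlepath pathfinish_part_circlepath cis_conv_exp [symmetric])
     (simp_all add: complex_eq_iff)

lemma semicircle_subset:
  assumes "R > 0" and "z \<in> path_image (part_circlepath 0 R (-pi/2) (pi/2))"
  shows "norm z = R" and "Re z \<ge> 0"
proof -
  obtain t where t: "z = of_real R * cis t" "-pi/2 \<le> t" "t \<le> pi/2"
    using assms by (auto simp: path_image_part_circlepath cis_conv_exp)
  show "norm z = R"
    using t assms by (simp add: norm_mult)
  have "cos t \<ge> 0"
    using t by (intro cos_ge_zero) auto
  thus "Re z \<ge> 0"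
    using t assms by simp
qed


text \<open>
  Folding the left half of the circle onto the right one by \<open>z \<mapsto> -z\<close>, this is the residue theorem for
  \<open>\<phi>(z) (1/z + z/R\<^sup>2)\<close> on the full circle. It can be proved without the left half: for the even function
  \<open>e(z) = \<phi>(z) + \<phi>(-z)\<close> the integrand differs from \<open>e(0)/z\<close> by an odd entire function, which has an even
  primitive and so integrates to \<open>0\<close> between the points \<open>\<plusminus>i R\<close>.
\<close>

lemma contour_integral_semicircle_even:
  fixes \<phi> :: "complex \<Rightarrow> complex"
  assumes \<phi>: "\<phi> holomorphic_on UNIV" and R: "R > 0"
  shows "((\<lambda>z. (\<phi> z + \<phi> (-z)) * (1 / z + z / of_real R ^ 2)) has_contour_integral
            (2 * of_real pi * \<i> * \<phi> 0)) (part_circlepath 0 R (-pi/2) (pi/2))"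
proof -
  define e where "e = (\<lambda>z. \<phi> z + \<phi> (-z))"
  \<comment> \<open>The value \<open>0\<close> of the quotient at \<open>0\<close> is its limit, since the derivative of the even function \<open>e\<close> vanishes there.\<close>
  define q where "q = (\<lambda>z. (if z = 0 then 0 else (e z - e 0) / z) + e z * (z / of_real R ^ 2))"
  have \<phi>': "(\<phi> has_field_derivative deriv \<phi> z) (at z)" for z
    using \<phi> by (intro holomorphic_derivI[of _ UNIV]) auto
  have e': "(e has_field_derivative (deriv \<phi> z - deriv \<phi> (-z))) (at z)" for z
    unfolding e_def
    by (rule derivative_eq_intros \<phi>' DERIV_chain2[OF \<phi>'] refl)+ simp
  have cont_e: "continuous_on UNIV e"
    by (intro continuous_at_imp_continuous_on ballI DERIV_isCont[OF e'])
  have "continuous_on UNIV q"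
  proof -
    have "isCont (\<lambda>z. if z = 0 then 0 else (e z - e 0) / z) z" for z
    proof (cases "z = 0")
      case True
      have "((\<lambda>h. (e (0 + h) - e 0) / h) \<longlongrightarrow> 0) (at 0)"
        using e'[of 0] by (simp add: DERIV_def)
      hence "((\<lambda>z. if z = 0 then 0 else (e z - e 0) / z) \<longlongrightarrow> 0) (at 0)"
        by (rule Lim_transform_eventually) (auto simp: eventually_at_filter)
      with True show ?thesis
        by (simp add: isCont_def)
    next
      case False
      have "isCont (\<lambda>z. (e z - e 0) / z) z"
        using False e' by (intro continuous_intros DERIV_isCont[of e]) auto
      moreover have "\<forall>\<^sub>F w in nhds z. (if w = 0 then 0 else (e w - e 0) / w) = (e w - e 0) / w"
        by (rule eventually_nhds_in_open[of "-{0}" z, THEN eventually_mono]) (use False in auto)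
      ultimately show ?thesis
        by (subst isCont_cong)
    qed
    thus ?thesis
      unfolding q_def using cont_e R
      by (intro continuous_on_add continuous_on_mult continuous_on_divide continuous_on_id continuous_on_const)
         (auto intro!: continuous_at_imp_continuous_on)
  qed
  moreover have "q field_differentiable at z" if "z \<in> interior UNIV - {0}" for z
  proof -
    have "(\<lambda>z. (e z - e 0) / z + e z * (z / of_real R ^ 2)) field_differentiable at z"
      using that e' R field_differentiable_def
      by (intro derivative_intros) auto
    thus ?thesis
      unfolding field_differentiable_def
      by (rule ex_forward)
         (rule has_field_derivative_transform_within_open[where S = "-{0}"], use that in \<open>auto simp: q_def\<close>)
  qed
  ultimately obtain Q where Q: "\<And>z. (Q has_field_derivative q z) (at z)"
    using holomorphic_convex_primitive[of UNIV "{0}" q] by auto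
  have odd: "q (-z) = - q z" for z
  proof -
    have "e (-z) = e z"
      by (simp add: e_def)
    thus ?thesis
      by (simp add: q_def)
  qed
  have "((\<lambda>z. Q z - Q (-z)) has_field_derivative 0) (at z within UNIV)" for z
    by (rule derivative_eq_intros Q DERIV_chain2[OF Q] refl)+ (simp add: odd)
  hence "\<exists>c. \<forall>z\<in>UNIV. Q z - Q (-z) = c"
    by (intro has_field_derivative_zero_constant) auto
  then obtain c where c: "\<And>z. Q z - Q (-z) = c"
    by auto
  from c[of 0] have "c = 0"
    by simp
  have "(q has_contour_integral Q (\<i> * of_real R) - Q (-\<i> * of_real R)) (part_circlepath 0 R (-pi/2) (pi/2))"
    using contour_integral_primitive[of UNIV Q q "part_circlepath 0 R (-pi/2) (pi/2)"] Q
    by (simp only: semicircle_endpoints) simp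
  hence q0: "(q has_contour_integral 0) (part_circlepath 0 R (-pi/2) (pi/2))"
    using c[of "\<i> * of_real R"] \<open>c = 0\<close> by simp
  have "((\<lambda>z. q z + e 0 * (1 / z)) has_contour_integral (0 + e 0 * (\<i> * of_real pi)))
          (part_circlepath 0 R (-pi/2) (pi/2))"
    by (intro has_contour_integral_add has_contour_integral_lmul q0 has_contour_integral_inverse_semicircle R)
  hence "((\<lambda>z. q z + e 0 * (1 / z)) has_contour_integral (2 * of_real pi * \<i> * \<phi> 0))
          (part_circlepath 0 R (-pi/2) (pi/2))"
    by (simp add: e_def algebra_simps)
  moreover have "q z + e 0 * (1 / z) = (\<phi> z + \<phi> (-z)) * (1 / z + z / of_real R ^ 2)"
    if "z \<in> path_image (part_circlepath 0 R (-pi/2) (pi/2))" for z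
  proof -
    have "z \<noteq> 0"
      using semicircle_subset(1)[OF R that] R by auto
    thus ?thesis
      by (simp add: q_def e_def diff_divide_distrib add_divide_distrib distrib_left distrib_right)
  qed
  ultimately show ?thesis
    by (rule has_contour_integral_eq)
qed

text \<open>
  A quantitative Riemann--Lebesgue lemma: \<open>N\<^sup>z\<close> has absolute value \<open>1\<close> on the imaginary axis and
  primitive \<open>N\<^sup>z / ln N\<close>, so integration by parts gains the factor \<open>1 / ln N\<close>.
\<close>

lemma contour_integral_oscillating_segment:
  fixes G :: "complex \<Rightarrow> complex"
  assumes G: "G holomorphic_on U" and U: "open U" and seg: "closed_segment a b \<subseteq> U"
    and "Re a = 0" "Re b = 0"
  obtains C where "C \<ge> 0" and
    "\<And>N::nat. N \<ge> 2 \<Longrightarrow> norm (contour_integral (linepath a b) (\<lambda>z. G z * of_nat N powr z)) \<le> C / ln (real N)"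
proof -
  have Re: "Re z = 0" if "z \<in> closed_segment a b" for z
    using that assms(4,5) by (auto simp: closed_segment_def)
  have contG: "continuous_on (closed_segment a b) G" and contG': "continuous_on (closed_segment a b) (deriv G)"
    using holomorphic_on_imp_continuous_on[OF G] holomorphic_on_imp_continuous_on[OF holomorphic_deriv[OF G U]]
      seg continuous_on_subset by blast+
  have bdd: "\<exists>B\<ge>0. \<forall>z\<in>closed_segment a b. norm (F z) \<le> B"
    if "continuous_on (closed_segment a b) F" for F :: "complex \<Rightarrow> complex"
  proof -
    have "bounded (F ` closed_segment a b)"
      using that by (intro compact_imp_bounded compact_continuous_image) auto
    then obtain B where "\<forall>z\<in>closed_segment a b. norm (F z) \<le> B"
      by (auto simp: bounded_iff)
    thus ?thesis
      by (intro exI[of _ "max B 0"]) (auto simp: le_max_iff_disj)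
  qed
  from bdd[OF contG] obtain B1 where B1: "B1 \<ge> 0" "\<And>z. z \<in> closed_segment a b \<Longrightarrow> norm (G z) \<le> B1"
    by auto
  from bdd[OF contG'] obtain B2 where B2: "B2 \<ge> 0" "\<And>z. z \<in> closed_segment a b \<Longrightarrow> norm (deriv G z) \<le> B2"
    by auto
  show ?thesis
  proof (rule that)
    show "2 * B1 + B2 * norm (b - a) \<ge> 0"
      using B1 B2 by simp
  next
    fix N :: nat assume N: "N \<ge> 2"
    define l where "l = ln (real N)"
    have l: "l > 0" using N by (simp add: l_def)
    define E where "E = (\<lambda>z::complex. of_nat N powr z)"
    have E1: "norm (E z) = 1" if "z \<in> closed_segment a b" for z
      using Re[OF that] N by (simp add: E_def)
    have contE: "continuous_on S E" for S
      unfolding E_def using N by (intro continuous_intros) auto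
    have E': "(E has_field_derivative of_real l * E z) (at z)" for z
      using has_field_derivative_powr_right[of "of_nat N" z] N Ln_of_real[of "real N"]
      by (simp add: E_def l_def)
    have "((\<lambda>z. G z * E z / of_real l) has_field_derivative (deriv G z * E z / of_real l + G z * E z))
            (at z within closed_segment a b)" if z: "z \<in> closed_segment a b" for z
    proof -
      have "(G has_field_derivative deriv G z) (at z)"
        using z seg by (intro holomorphic_derivI[OF G U]) auto
      from DERIV_cdivide[OF DERIV_mult[OF this E'], of "of_real l"]
      show ?thesis
        using l by (auto intro!: has_field_derivative_at_within simp: add_divide_distrib mult_ac)
    qed
    from contour_integral_primitive[OF this, of "linepath a b"]
    have 1: "((\<lambda>z. deriv G z * E z / of_real l + G z * E z) has_contour_integral
             (G b * E b / of_real l - G a * E a / of_real l)) (linepath a b)"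
      by simp
    have "(\<lambda>z. deriv G z * E z / of_real l) contour_integrable_on linepath a b"
      using contG' contE l by (intro contour_integrable_continuous_linepath continuous_intros) auto
    then obtain J where J: "((\<lambda>z. deriv G z * E z / of_real l) has_contour_integral J) (linepath a b)"
      by (auto simp: contour_integrable_on_def)
    have nJ: "norm J \<le> B2 / l * norm (b - a)"
    proof (rule has_contour_integral_bound_linepath[OF J])
      fix z assume z: "z \<in> closed_segment a b"
      show "norm (deriv G z * E z / of_real l) \<le> B2 / l"
        using B2(2)[OF z] E1[OF z] l by (simp add: norm_mult norm_divide divide_right_mono)
    qed (use B2 l in auto)
    have "((\<lambda>z. G z * E z) has_contour_integral (G b * E b / of_real l - G a * E a / of_real l - J)) (linepath a b)"
      using has_contour_integral_diff[OF 1 J] by simp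
    hence "contour_integral (linepath a b) (\<lambda>z. G z * E z) = G b * E b / of_real l - G a * E a / of_real l - J"
      by (rule contour_integral_unique)
    also have "norm \<dots> \<le> norm (G b * E b / of_real l) + norm (G a * E a / of_real l) + norm J"
      by (meson norm_triangle_ineq4 order_trans add_right_mono)
    also have "\<dots> \<le> B1 / l + B1 / l + B2 / l * norm (b - a)"
    proof (intro add_mono nJ)
      show "norm (G b * E b / of_real l) \<le> B1 / l" "norm (G a * E a / of_real l) \<le> B1 / l"
        using B1(2)[of a] B1(2)[of b] E1[of a] E1[of b] l
        by (auto simp: norm_mult norm_divide intro!: divide_right_mono)
    qed
    also have "\<dots> = (2 * B1 + B2 * norm (b - a)) / l"
      by (simp add: add_divide_distrib)
    finally show "norm (contour_integral (linepath a b) (\<lambda>z. G z * of_nat N powr z)) \<le> (2 * B1 + B2 * norm (b - a)) / ln (real N)"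
      by (simp add: E_def l_def)
  qed
qed

text \<open>
  Put \<open>f(z) = z g(z)\<close>, the sum of the series, let \<open>P(z)\<close> be its partial sum over \<open>n < N\<close>, and let \<open>A\<close> be the
  right half of the circle of radius \<open>R\<close>. Newman's kernel \<open>k(z) = 1/z + z/R\<^sup>2\<close> has absolute value
  \<open>2 Re z / R\<^sup>2\<close> on the circle. By \<open>contour_integral_semicircle_even\<close>, \<open>2 \<pi> i P(0)\<close> is the integral of
  \<open>(P(z) N\<^sup>z + P(-z) N\<^bsup>-z\<^esup>) k(z)\<close> over \<open>A\<close>. Replacing \<open>P(z)\<close> by \<open>f(z)\<close> in the first summand turns it
  into \<open>g(z) (1 + z\<^sup>2/R\<^sup>2) N\<^sup>z\<close>, which has no pole; its integral can be moved to the segment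
  from \<open>-i R\<close> to \<open>i R\<close>, where it is \<open>O(1 / ln N)\<close>. For \<open>x = Re z > 0\<close> both the remainder
  \<open>(P(z) - f(z)) N\<^sup>z\<close> and \<open>P(-z) N\<^bsup>-z\<^esup>\<close> are \<open>O(1/x)\<close>, since the coefficients are bounded by \<open>1\<close>; the factor
  \<open>x\<close> in the kernel compensates this, and the integral of the remaining terms is \<open>O(1/R)\<close> uniformly in \<open>N \<ge> R\<close>.
  The choice of \<open>g\<close> encodes that \<open>f(0) = 0\<close>.
\<close>

theorem newman_tauberian:
  fixes a :: "nat \<Rightarrow> complex" and g :: "complex \<Rightarrow> complex"
  assumes a: "\<And>n. norm (a n) \<le> 1"
    and g: "g holomorphic_on U" and U: "open U" "{z. Re z \<ge> 0} \<subseteq> U"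
    and series: "\<And>z. Re z > 0 \<Longrightarrow> (\<lambda>n. a n * of_nat n powr (-1 - z)) sums (z * g z)"
  shows "(\<lambda>N. \<Sum>n<N. a n / of_nat n) \<longlonglongrightarrow> 0"
proof -
  define S where "S N = (\<Sum>n<N. a n / of_nat n)" for N
  have key: "\<exists>C\<ge>0. \<forall>N::nat. N \<ge> 2 \<longrightarrow> real N \<ge> R \<longrightarrow> norm (S N) \<le> 3 / R + C / ln (real N)"
    if R: "R > 0" for R :: real
  proof -
    define A where "A = part_circlepath 0 R (-pi/2) (pi/2)"
    define k where "k = (\<lambda>z::complex. 1 / z + z / of_real R ^ 2)"
    define G where "G = (\<lambda>z. g z * (1 + (z / of_real R) ^ 2))"
    have G: "G holomorphic_on U"
      unfolding G_def using g R by (intro holomorphic_intros) auto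
    have "closed_segment (-\<i> * of_real R) (\<i> * of_real R) \<subseteq> U"
      using U(2) by (auto simp: closed_segment_def)
    from contour_integral_oscillating_segment[OF G U(1) this]
    obtain C where C: "C \<ge> 0" "\<And>N::nat. N \<ge> 2 \<Longrightarrow>
        norm (contour_integral (linepath (-\<i> * of_real R) (\<i> * of_real R)) (\<lambda>z. G z * of_nat N powr z)) \<le> C / ln (real N)"
      by auto
    have "norm (S N) \<le> 3 / R + C / ln (real N)" if N: "N \<ge> 2" "real N \<ge> R" for N :: nat
    proof -
      define I where "I = contour_integral (linepath (-\<i> * of_real R) (\<i> * of_real R)) (\<lambda>z. G z * of_nat N powr z)"
      define P where "P = (\<lambda>z. \<Sum>n<N. a n * of_nat n powr (-1 - z))"
      have P0: "P 0 = S N"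
        by (simp add: P_def S_def powr_minus field_simps)
      have holH: "(\<lambda>z. G z * of_nat N powr z) holomorphic_on U"
        using N by (intro holomorphic_intros G) auto
      have int_H: "((\<lambda>z. G z * of_nat N powr z) has_contour_integral I) A"
      proof -
        let ?H = "\<lambda>z. G z * of_nat N powr z"
        let ?l = "linepath (\<i> * of_real R) (-\<i> * of_real R)"
        have half: "path_image A \<subseteq> {z. Re z \<ge> 0}"
          using semicircle_subset(2)[OF R] by (auto simp: A_def)
        have seg: "closed_segment (\<i> * of_real R) (-\<i> * of_real R) \<subseteq> {z. Re z \<ge> 0}"
          by (auto simp: closed_segment_def)
        have contH: "continuous_on {z. Re z \<ge> 0} ?H"
          using holomorphic_on_imp_continuous_on[OF holH] U(2) continuous_on_subset by blast
        have "(?H has_contour_integral 0) (A +++ ?l)"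
        proof (rule Cauchy_theorem_convex_simple)
          show "?H holomorphic_on {z. Re z \<ge> 0}"
            using holH U(2) holomorphic_on_subset by blast
          show "convex {z. Re z \<ge> 0}"
            by (rule convex_halfspace_Re_ge)
          show "valid_path (A +++ ?l)"
            unfolding A_def
            by (intro valid_path_join valid_path_part_circlepath valid_path_linepath)
               (simp only: semicircle_endpoints pathstart_linepath)
          show "path_image (A +++ ?l) \<subseteq> {z. Re z \<ge> 0}"
            using half seg by (intro subset_path_image_join) auto
        qed (simp only: A_def pathstart_join pathfinish_join pathfinish_linepath semicircle_endpoints)
        moreover have "?H contour_integrable_on A"
          unfolding A_def using half contH
          by (intro contour_integrable_continuous_part_circlepath) (auto simp: A_def intro: continuous_on_subset)
        moreover have l: "?H contour_integrable_on ?l"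
          using seg contH by (intro contour_integrable_continuous_linepath) (auto intro: continuous_on_subset)
        ultimately have "contour_integral A ?H + contour_integral ?l ?H = 0"
          by (metis A_def contour_integral_join contour_integral_unique valid_path_linepath valid_path_part_circlepath)
        moreover have "contour_integral ?l ?H = - I"
          unfolding I_def using contour_integral_reversepath[of "linepath (-\<i> * of_real R) (\<i> * of_real R)" ?H]
          by simp
        ultimately have "contour_integral A ?H = I"
          by simp
        with \<open>?H contour_integrable_on A\<close> show ?thesis
          using has_contour_integral_integral by metis
      qed
      define \<phi> where "\<phi> = (\<lambda>z. P z * of_nat N powr z)"
      have "\<phi> holomorphic_on UNIV"
      proof -
        have "(\<lambda>z. a n * of_nat n powr (-1 - z)) holomorphic_on UNIV" for n
          by (cases "n = 0") (auto intro!: holomorphic_intros)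
        thus ?thesis
          unfolding \<phi>_def P_def using N by (intro holomorphic_intros) auto
      qed
      from contour_integral_semicircle_even[OF this R]
      have "((\<lambda>z. (\<phi> z + \<phi> (-z)) * k z) has_contour_integral (2 * of_real pi * \<i> * S N)) A"
        using N by (simp add: k_def A_def \<phi>_def P0)
      from has_contour_integral_diff[OF this int_H]
      have diff: "((\<lambda>z. (\<phi> z + \<phi> (-z)) * k z - G z * of_nat N powr z) has_contour_integral
                    (2 * of_real pi * \<i> * S N - I)) A" .
      \<comment> \<open>The endpoints \<open>\<plusminus>i R\<close> of the semicircle are excluded, because the series need not converge there.\<close>
      have "norm (2 * of_real pi * \<i> * S N - I) \<le> 6 / R\<^sup>2 * R * (pi/2 - (-pi/2))"
      proof (rule has_contour_integral_bound_part_circlepath_strong[OF diff[unfolded A_def]])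
        show "finite {z::complex. norm z = R \<and> Re z = 0}"
        proof (rule finite_subset)
          show "{z::complex. norm z = R \<and> Re z = 0} \<subseteq> {Complex 0 R, Complex 0 (-R)}"
            using R by (auto simp: cmod_def complex_eq_iff abs_if split: if_splits)
        qed auto
        fix z assume z: "z \<in> path_image (part_circlepath 0 R (-pi/2) (pi/2)) - {z. norm z = R \<and> Re z = 0}"
        define x where "x = Re z"
        have nz: "norm z = R" and x: "x > 0"
          using z semicircle_subset[OF R, of z] by (auto simp: x_def)
        have z0: "z \<noteq> 0"
          using nz R by auto
        have kz: "norm (k z) = 2 * x / R\<^sup>2"
        proof -
          have "1 / z = cnj z / of_real R ^ 2"
            using nz z0 complex_norm_square[of z] by (simp add: field_simps power2_eq_square)
          hence "k z = (cnj z + z) / of_real R ^ 2"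
            by (simp add: k_def add_divide_distrib)
          also have "cnj z + z = of_real (2 * x)"
            by (simp add: x_def complex_eq_iff)
          finally show ?thesis
            using x by (simp add: norm_divide norm_power)
        qed
        have "x \<le> R"
          using nz complex_Re_le_cmod[of z] by (simp add: x_def)
        have N0: "real N > 0" using N by simp
        have Gk: "G z = z * g z * k z"
          using z0 by (simp add: G_def k_def field_simps power2_eq_square)
        have "(\<phi> z + \<phi> (-z)) * k z - G z * of_nat N powr z =
                ((P z - z * g z) * of_nat N powr z + P (-z) * of_nat N powr (-z)) * k z"
          by (simp add: \<phi>_def Gk algebra_simps)
        also have "norm \<dots> \<le> (norm (P z - z * g z) * real N powr x + norm (P (-z)) * real N powr (-x)) * norm (k z)"
          unfolding norm_mult[of _ "k z"] x_def
          by (intro mult_right_mono norm_ge_zero order.trans[OF norm_triangle_ineq]) (simp add: norm_mult)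
        also have "\<dots> \<le> (2 / x + 1 / x) * norm (k z)"
        proof (intro mult_right_mono add_mono norm_ge_zero)
          have sm: "summable (\<lambda>n. real (n + N) powr (-1 - x))"
            using x by (subst summable_iff_shift) (simp add: summable_real_powr_iff)
          have "(\<lambda>n. a (n + N) * of_nat (n + N) powr (-1 - z)) sums (z * g z - P z)"
            unfolding P_def using series[of z] x by (subst sums_iff_shift) (simp add: x_def)
          hence "z * g z - P z = (\<Sum>n. a (n + N) * of_nat (n + N) powr (-1 - z))"
            by (rule sums_unique)
          also have "norm \<dots> \<le> (\<Sum>n. real (n + N) powr (-1 - x))"
          proof (rule norm_suminf_le[OF _ sm])
            fix n
            have "norm (a (n + N)) * real (n + N) powr (-1 - x) \<le> 1 * real (n + N) powr (-1 - x)"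
              by (intro mult_right_mono a) auto
            thus "norm (a (n + N) * of_nat (n + N) powr (-1 - z)) \<le> real (n + N) powr (-1 - x)"
              by (simp add: norm_mult x_def del: of_nat_add)
          qed
          finally have "norm (P z - z * g z) \<le> (\<Sum>n. real (n + N) powr (-1 - x))"
            by (simp add: norm_minus_commute)
          hence "x * norm (P z - z * g z) \<le> x * (\<Sum>n. real (n + N) powr (-1 - x))"
            using x by (intro mult_left_mono) auto
          also have "\<dots> \<le> real N powr (-x) * (1 + x / real N)"
            using suminf_powr_tail_le[OF x, of N] N by simp
          also have "\<dots> \<le> real N powr (-x) * 2"
            using \<open>x \<le> R\<close> N x by (intro mult_left_mono) auto
          finally have "x * norm (P z - z * g z) * real N powr x \<le> real N powr (-x) * 2 * real N powr x"
            by (intro mult_right_mono) auto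
          also have "\<dots> = 2"
            using N0 by (simp add: powr_minus)
          finally show "norm (P z - z * g z) * real N powr x \<le> 2 / x"
            using x by (simp add: field_simps)
        next
          have "norm (P (-z)) \<le> (\<Sum>n<N. real n powr (x - 1))"
            unfolding P_def
          proof (rule sum_norm_le)
            fix n
            have "norm (a n) * real n powr (x - 1) \<le> 1 * real n powr (x - 1)"
              by (intro mult_right_mono a) auto
            thus "norm (a n * of_nat n powr (-1 - -z)) \<le> real n powr (x - 1)"
              by (simp add: norm_mult x_def)
          qed
          hence "x * norm (P (-z)) \<le> x * (\<Sum>n<N. real n powr (x - 1))"
            using x by (intro mult_left_mono) auto
          also have "\<dots> \<le> real N powr x"
            by (rule sum_powr_le[OF x])
          finally have "x * norm (P (-z)) * real N powr (-x) \<le> real N powr x * real N powr (-x)"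
            by (intro mult_right_mono) auto
          also have "\<dots> = 1"
            using N0 by (simp add: powr_minus)
          finally show "norm (P (-z)) * real N powr (-x) \<le> 1 / x"
            using x by (simp add: field_simps)
        qed
        also have "\<dots> = 6 / R\<^sup>2"
          using x by (simp add: kz)
        finally show "norm ((\<phi> z + \<phi> (-z)) * k z - G z * of_nat N powr z) \<le> 6 / R\<^sup>2" .
      qed (use R in auto)
      also have "\<dots> = 6 * pi / R"
        using R by (simp add: power2_eq_square)
      finally have "norm (2 * of_real pi * \<i> * S N - I) \<le> 6 * pi / R" .
      moreover have "norm I \<le> C / ln (real N)"
        unfolding I_def by (rule C(2)[OF N(1)])
      moreover have "norm (2 * of_real pi * \<i> * S N) \<le> norm (2 * of_real pi * \<i> * S N - I) + norm I"
        by (metis norm_triangle_sub add.commute)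
      ultimately have "2 * pi * norm (S N) \<le> 6 * pi / R + C / ln (real N)"
        by (simp add: norm_mult)
      also have "\<dots> \<le> 6 * pi / R + 2 * pi * (C / ln (real N))"
      proof -
        have "C / ln (real N) \<ge> 0"
          using C(1) N by simp
        moreover have "1 \<le> 2 * pi"
          using pi_gt3 by simp
        ultimately show ?thesis
          using mult_right_mono[of 1 "2 * pi" "C / ln (real N)"] by simp
      qed
      also have "\<dots> = 2 * pi * (3 / R + C / ln (real N))"
        by (simp add: distrib_left)
      finally show ?thesis
        by simp
    qed
    with C(1) show ?thesis by blast
  qed
  have "S \<longlonglongrightarrow> 0"
  proof (rule tendstoI)
    fix e :: real assume e: "e > 0"
    from key[of "6 / e"] e obtain C where C: "C \<ge> 0"
      "\<And>N. N \<ge> 2 \<Longrightarrow> real N \<ge> 6 / e \<Longrightarrow> norm (S N) \<le> e / 2 + C / ln (real N)"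
      by auto
    have "(\<lambda>N. C / ln (real N)) \<longlonglongrightarrow> 0"
      by real_asymp
    hence "\<forall>\<^sub>F N in sequentially. C / ln (real N) < e / 2"
      by (rule order_tendstoD) (use e in auto)
    moreover have "\<forall>\<^sub>F N in sequentially. real N \<ge> 6 / e"
      using filterlim_real_sequentially by (auto simp: filterlim_at_top)
    ultimately show "\<forall>\<^sub>F N in sequentially. dist (S N) 0 < e"
      using eventually_ge_at_top[of 2]
    proof eventually_elim
      case (elim N)
      have "norm (S N) \<le> e / 2 + C / ln (real N)"
        using elim by (intro C(2))
      hence "norm (S N) < e"
        using elim(1) by linarith
      thus ?case
        by simp
    qed
  qed
  thus ?thesis
    by (simp add: S_def [abs_def])
qed

section \<open>The Moebius function has mean value zero\<close>

text \<open>
  Newman's theorem applies with \<open>g(z) = 1 / (z \<zeta>(1+z))\<close>, since \<open>\<Sum>\<mu>(n)/n\<^bsup>1+z\<^esup> = 1/\<zeta>(1+z)\<close>; the zeros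
  of the zeta function stay away from the closed half-plane \<open>Re z \<ge> 0\<close>.
\<close>

lemma sum_moebius_over_n_tendsto_0: "(\<lambda>N. \<Sum>n<N. real_of_int (moebius_mu n) / real n) \<longlonglongrightarrow> 0"
proof -
  define h where "h = (\<lambda>z. zeta_reg (1 + z))"
  define U where "U = {z. Re z > -1} \<inter> h -` (-{0})"
  have h: "h holomorphic_on {z. Re z > -1}"
  proof -
    have "(zeta_reg \<circ> (\<lambda>z. 1 + z)) holomorphic_on {z. Re z > -1}"
      by (rule holomorphic_on_compose_gen[OF _ holomorphic_zeta_reg]) (auto intro!: holomorphic_intros)
    thus ?thesis by (simp add: h_def o_def)
  qed
  have "open U"
    unfolding U_def using holomorphic_on_imp_continuous_on[OF h]
    by (intro continuous_open_preimage open_halfspace_Re_gt) auto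
  moreover have "{z. Re z \<ge> 0} \<subseteq> U"
    using zeta_reg_nonzero by (auto simp: U_def h_def)
  moreover have "(\<lambda>z. 1 / h z) holomorphic_on U"
    by (intro holomorphic_intros holomorphic_on_subset[OF h]) (auto simp: U_def)
  moreover have "(\<lambda>n. of_int (moebius_mu n) * of_nat n powr (-1 - z)) sums (z * (1 / h z))" if z: "Re z > 0" for z
  proof -
    have s: "Re (1 + z) > 1"
      using z by simp
    have eq: "- (1 + z) = -1 - z"
      by simp
    have "summable (\<lambda>n. of_int (moebius_mu n) * of_nat n powr (-1 - z) :: complex)"
      using summable_norm_cancel[OF summable_norm_dirichlet_bounded[OF norm_moebius_mu_le_1 s]] unfolding eq .
    moreover have "h z = z * zeta_series (1 + z)"
      using zeta_reg_eq_zeta_series[OF s] by (simp add: h_def)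
    hence "z * (1 / h z) = 1 / zeta_series (1 + z)"
      using z by auto
    moreover have "(\<Sum>n. of_int (moebius_mu n) * of_nat n powr (-1 - z)) = 1 / zeta_series (1 + z)"
      using dirichlet_series_moebius[OF s] zeta_series_nonzero[OF s] unfolding eq by (simp add: field_simps)
    ultimately show ?thesis
      by (simp only: sums_iff)
  qed
  moreover note norm_moebius_mu_le_1
  ultimately have "(\<lambda>N. \<Sum>n<N. of_int (moebius_mu n) / of_nat n :: complex) \<longlonglongrightarrow> 0"
    using newman_tauberian[where g = "\<lambda>z. 1 / h z" and U = U and a = "\<lambda>n. of_int (moebius_mu n)"]
    by blast
  hence "(\<lambda>N. complex_of_real (\<Sum>n<N. real_of_int (moebius_mu n) / real n)) \<longlonglongrightarrow> of_real 0"
    by simp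
  thus ?thesis
    by (simp only: tendsto_of_real_iff)
qed

lemma cesaro_null:
  fixes s :: "nat \<Rightarrow> real"
  assumes "s \<longlonglongrightarrow> 0"
  shows "(\<lambda>N. (\<Sum>n=1..N. s n) / real N) \<longlonglongrightarrow> 0"
proof (rule tendstoI)
  fix e :: real assume e: "e > 0"
  obtain M where M: "\<And>n. n \<ge> M \<Longrightarrow> \<bar>s n\<bar> < e / 2"
    using LIMSEQ_D[OF assms, of "e/2"] e by auto
  define K where "K = (\<Sum>n=1..M. \<bar>s n\<bar>)"
  have bound: "\<bar>\<Sum>n=1..N. s n\<bar> \<le> K + real N * (e / 2)" for N
  proof -
    have "\<bar>\<Sum>n=1..N. s n\<bar> \<le> (\<Sum>n=1..N. \<bar>s n\<bar>)"
      by (rule sum_abs)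
    also have "\<dots> \<le> (\<Sum>n=1..N. (if n \<le> M then \<bar>s n\<bar> else 0) + e / 2)"
      using M e by (intro sum_mono) (auto simp: less_imp_le not_le)
    also have "\<dots> = (\<Sum>n=1..N. if n \<le> M then \<bar>s n\<bar> else 0) + real N * (e / 2)"
      by (simp add: sum.distrib)
    also have "(\<Sum>n=1..N. if n \<le> M then \<bar>s n\<bar> else 0) = (\<Sum>n\<in>{n\<in>{1..N}. n \<le> M}. \<bar>s n\<bar>)"
      by (rule sum.inter_filter[symmetric]) simp
    also have "\<dots> \<le> K"
      unfolding K_def by (rule sum_mono2) auto
    finally show ?thesis by simp
  qed
  have "(\<lambda>N. K / real N) \<longlonglongrightarrow> 0"
    by real_asymp
  hence "\<forall>\<^sub>F N in sequentially. K / real N < e / 2"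
    by (rule order_tendstoD) (use e in auto)
  thus "\<forall>\<^sub>F N in sequentially. dist ((\<Sum>n=1..N. s n) / real N) 0 < e"
    using eventually_gt_at_top[of 0]
  proof eventually_elim
    case (elim N)
    have "\<bar>\<Sum>n=1..N. s n\<bar> / real N \<le> (K + real N * (e / 2)) / real N"
      by (intro divide_right_mono bound) auto
    also have "\<dots> = K / real N + e / 2"
      using elim by (simp add: add_divide_distrib)
    also have "\<dots> < e"
      using elim by linarith
    finally show ?case
      by simp
  qed
qed

lemma weighted_mean_null:
  fixes c :: "nat \<Rightarrow> real"
  assumes "(\<lambda>N. \<Sum>n<N. c n) \<longlonglongrightarrow> 0"
  shows "(\<lambda>N. (\<Sum>n=1..N. real n * c n) / real N) \<longlonglongrightarrow> 0"
proof -
  define s where "s N = (\<Sum>n<N. c n)" for N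
  have s: "s \<longlonglongrightarrow> 0"
    using assms by (simp add: s_def [abs_def])
  \<comment> \<open>Summation by parts.\<close>
  have abel: "(\<Sum>n=1..N. real n * c n) = real N * s (Suc N) - (\<Sum>n=1..N. s n)" for N
    by (induction N) (auto simp: s_def algebra_simps)
  have "(\<lambda>N. s (Suc N) - (\<Sum>n=1..N. s n) / real N) \<longlonglongrightarrow> 0 - 0"
    by (intro tendsto_diff LIMSEQ_Suc s cesaro_null)
  moreover have "\<forall>\<^sub>F N in sequentially. s (Suc N) - (\<Sum>n=1..N. s n) / real N = (\<Sum>n=1..N. real n * c n) / real N"
    using eventually_gt_at_top[of 0]
    by eventually_elim (simp add: abel diff_divide_distrib del: One_nat_def)
  ultimately show ?thesis
    using Lim_transform_eventually by fastforce
qed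

theorem mean_moebius_mu: "(\<lambda>N. (\<Sum>n=1..N. real_of_int (moebius_mu n)) / real N) \<longlonglongrightarrow> 0"
proof -
  have "(\<Sum>n=1..N. real_of_int (moebius_mu n)) = (\<Sum>n=1..N. real n * (real_of_int (moebius_mu n) / real n))" for N
    by (intro sum.cong) auto
  thus ?thesis
    using weighted_mean_null[OF sum_moebius_over_n_tendsto_0] by (simp only:)
qed

section \<open>The density of the squarefree numbers\<close>

text \<open>
  This is \<open>1 / \<zeta>(2)\<close>, with \<open>\<zeta>(2) = \<pi>\<^sup>2 / 6\<close>.
\<close>

lemma sums_moebius_over_square: "(\<lambda>d. real_of_int (moebius_mu d) / real d ^ 2) sums (6 / pi\<^sup>2)"
proof -
  have pw: "(of_nat n :: complex) powr (-2) = of_real (1 / real n ^ 2)" for n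
    using powr_of_int[of n "-2"]
    by (cases "n = 0") (simp_all add: powr_minus divide_simps)
  have "(\<lambda>n. 1 / real (Suc n) ^ 2) sums (pi\<^sup>2 / 6)"
    using inverse_squares_sums by (simp add: add.commute)
  hence "(\<lambda>n. 1 / real n ^ 2) sums (pi\<^sup>2 / 6)"
    by (subst (asm) sums_Suc_iff) simp
  hence "(\<lambda>n. complex_of_real (1 / real n ^ 2)) sums of_real (pi\<^sup>2 / 6)"
    by (rule sums_of_real)
  hence z2: "zeta_series 2 = of_real (pi\<^sup>2 / 6)"
    unfolding zeta_series_def pw by (rule sums_unique[symmetric])
  have "(\<lambda>n. of_int (moebius_mu n) * of_nat n powr (-2)) sums (\<Sum>n. of_int (moebius_mu n) * of_nat n powr (-2) :: complex)"
    using summable_norm_cancel[OF summable_norm_dirichlet_bounded[OF norm_moebius_mu_le_1, of 2]] by (intro summable_sums) simp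
  also have "(\<Sum>n. of_int (moebius_mu n) * of_nat n powr (-2) :: complex) = 1 / of_real (pi\<^sup>2 / 6)"
    using dirichlet_series_moebius[of 2] z2 by (simp add: field_simps)
  finally have "(\<lambda>n. complex_of_real (of_int (moebius_mu n) / real n ^ 2)) sums of_real (6 / pi\<^sup>2)"
    by (simp add: pw)
  thus ?thesis
    by (subst (asm) sums_of_real_iff)
qed

text \<open>
  There are \<open>\<Sum>d. \<mu>(d) (N div d\<^sup>2)\<close> squarefree numbers up to \<open>N\<close>. After division by \<open>N\<close> the terms are
  dominated by \<open>1/d\<^sup>2\<close>, so Tannery's theorem permits passing to the limit term by term.
\<close>

theorem mean_squarefree: "(\<lambda>N. (\<Sum>n=1..N. of_bool (squarefree n)) / real N) \<longlonglongrightarrow> 6 / pi\<^sup>2"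
proof -
  define f where "f d N = real_of_int (moebius_mu d) * (real (N div d\<^sup>2) / real N)" for d N
  have count: "(\<Sum>n=1..N. of_bool (squarefree n)) / real N = (\<Sum>d. f d N)" for N
  proof -
    have "(\<Sum>n=1..N. of_bool (squarefree n) :: real) =
            (\<Sum>n\<in>{1..N}. \<Sum>d\<in>{d\<in>{1..N}. d\<^sup>2 dvd n}. real_of_int (moebius_mu d))"
    proof (intro sum.cong refl)
      fix n assume n: "n \<in> {1..N}"
      have "d \<le> n" "d > 0" if "d\<^sup>2 dvd n" for d
      proof -
        show "d > 0" using that n by (auto intro: Nat.gr0I)
        have "d \<le> d\<^sup>2" by (simp add: power2_eq_square)
        also have "\<dots> \<le> n" using that n by (auto dest: dvd_imp_le)
        finally show "d \<le> n" .
      qed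
      hence "{d\<in>{1..N}. d\<^sup>2 dvd n} = {d. d\<^sup>2 dvd n}"
        using n by (auto intro: order.trans simp: Suc_le_eq)
      moreover have "(of_bool (squarefree n) :: real) = of_int (of_bool (squarefree n))"
        by simp
      moreover have "of_bool (squarefree n) = (\<Sum>d | d\<^sup>2 dvd n. moebius_mu d)"
        using n by (intro of_bool_squarefree_eq_sum) auto
      ultimately show "of_bool (squarefree n) = (\<Sum>d\<in>{d\<in>{1..N}. d\<^sup>2 dvd n}. real_of_int (moebius_mu d))"
        by (simp only: of_int_sum)
    qed
    also have "\<dots> = (\<Sum>d\<in>{1..N}. \<Sum>n\<in>{n\<in>{1..N}. d\<^sup>2 dvd n}. real_of_int (moebius_mu d))"
      by (rule sum.swap_restrict) auto
    also have "\<dots> = (\<Sum>d\<in>{1..N}. real_of_int (moebius_mu d) * real (N div d\<^sup>2))"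
    proof (intro sum.cong refl)
      fix d assume d: "d \<in> {1..N}"
      have "(\<Sum>n\<in>{n\<in>{1..N}. d\<^sup>2 dvd n}. real_of_int (moebius_mu d)) =
              real_of_int (moebius_mu d) * (\<Sum>n\<in>{n\<in>{1..N}. d\<^sup>2 dvd n}. 1)"
        by simp
      also have "(\<Sum>n\<in>{n\<in>{1..N}. d\<^sup>2 dvd n}. 1) = (\<Sum>n=1..N. if d\<^sup>2 dvd n then 1 else 0 :: real)"
        by (rule sum.inter_filter) simp
      also have "\<dots> = real (N div d\<^sup>2)"
        using sum_multiples[of "d\<^sup>2" "\<lambda>_. 1::real" N] d by simp
      finally show "(\<Sum>n\<in>{n\<in>{1..N}. d\<^sup>2 dvd n}. real_of_int (moebius_mu d)) =
          real_of_int (moebius_mu d) * real (N div d\<^sup>2)" .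
    qed
    also have "\<dots> / real N = (\<Sum>d\<in>{1..N}. f d N)"
      by (simp add: f_def sum_divide_distrib)
    also have "\<dots> = (\<Sum>d. f d N)"
    proof (rule suminf_finite[symmetric])
      fix d assume "d \<notin> {1..N}"
      then consider "d = 0" | "d > N" by force
      thus "f d N = 0"
      proof cases
        case 2
        have "d \<le> d\<^sup>2" by (simp add: power2_eq_square)
        hence "N < d\<^sup>2" using 2 by linarith
        thus ?thesis by (simp add: f_def)
      qed (simp add: f_def)
    qed auto
    finally show ?thesis .
  qed
  have "(\<lambda>N. \<Sum>d. f d N) \<longlonglongrightarrow> (\<Sum>d. real_of_int (moebius_mu d) / real d ^ 2)"
  proof (rule tannerys_theorem[THEN conjunct2, THEN conjunct2])
    show "(\<lambda>N. f d N) \<longlonglongrightarrow> real_of_int (moebius_mu d) / real d ^ 2" for d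
    proof (cases "d = 0")
      case False
      have "(\<lambda>N. f d N) \<longlonglongrightarrow> real_of_int (moebius_mu d) * (1 / real (d\<^sup>2))"
        unfolding f_def using False by (intro tendsto_mult tendsto_const LIMSEQ_div_nat) auto
      thus ?thesis by simp
    qed (simp add: f_def)
    show "summable (\<lambda>d. 1 / real d ^ 2)"
      using inverse_power_summable[of 2, where ?'a = real] by (simp add: field_simps)
    have "norm (f d N) \<le> 1 / real d ^ 2" for d N
    proof -
      have "real (N div d\<^sup>2) / real N \<le> 1 / real d ^ 2"
      proof (cases "N = 0 \<or> d = 0")
        case False
        have "real (N div d\<^sup>2) \<le> real N / real (d\<^sup>2)"
          by (rule of_nat_div_le_of_nat)
        with False show ?thesis by (simp add: field_simps)
      qed auto
      thus ?thesis
        using mult_mono[OF abs_moebius_mu_le_1[of d], of "real (N div d\<^sup>2) / real N" "1 / real d ^ 2"]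
        by (simp add: f_def abs_mult)
    qed
    thus "\<forall>\<^sub>F (d, N) in sequentially \<times>\<^sub>F sequentially. norm (f d N) \<le> 1 / real d ^ 2"
      by (intro always_eventually) auto
  qed auto
  thus ?thesis
    by (simp only: count sums_unique[OF sums_moebius_over_square, symmetric])
qed

section \<open>Sieving by finitely many primes\<close>

text \<open>
  Iterating the recursive inequality \<open>j\<close> times leaves at most \<open>K / 2\<^sup>j\<close> and a geometric sum of errors.
\<close>

lemma contraction_tendsto_0:
  fixes b e :: "nat \<Rightarrow> real"
  assumes bound: "\<And>N. \<bar>b N\<bar> \<le> K" and rec: "\<And>N. \<bar>b N\<bar> \<le> e N + \<bar>b (N div p)\<bar> / 2"
    and e: "e \<longlonglongrightarrow> 0" and p: "p > 0"
  shows "b \<longlonglongrightarrow> 0"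
proof (rule tendstoI)
  fix \<epsilon> :: real assume \<epsilon>: "\<epsilon> > 0"
  define \<delta> where "\<delta> = \<epsilon> / 4"
  have \<delta>: "\<delta> > 0" using \<epsilon> by (simp add: \<delta>_def)
  have ev_e: "\<forall>\<^sub>F N in sequentially. e N < \<delta>"
    using order_tendstoD(2)[OF e \<delta>] .
  have iter: "\<forall>\<^sub>F N in sequentially. \<bar>b N\<bar> \<le> K / 2 ^ j + 2 * \<delta>" for j
  proof (induction j)
    case 0
    have "\<bar>b N\<bar> \<le> K + 2 * \<delta>" for N
      using bound[of N] \<delta> by simp
    thus ?case by simp
  next
    case (Suc j)
    from ev_e eventually_compose_filterlim[OF Suc filterlim_div_nat[OF p]] show ?case
    proof eventually_elim
      case (elim N)
      thus ?case using rec[of N] by simp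
    qed
  qed
  have "(\<lambda>j. K / 2 ^ j) \<longlonglongrightarrow> 0"
    by real_asymp
  hence "\<forall>\<^sub>F j in sequentially. K / 2 ^ j < \<delta>"
    by (rule order_tendstoD) (rule \<delta>)
  then obtain j where j: "K / 2 ^ j < \<delta>"
    by (auto simp: eventually_sequentially)
  from iter[of j] show "\<forall>\<^sub>F N in sequentially. dist (b N) 0 < \<epsilon>"
  proof eventually_elim
    case (elim N)
    have "\<bar>b N\<bar> < \<epsilon>"
      using elim j \<delta> unfolding \<delta>_def by linarith
    thus ?case by simp
  qed
qed

text \<open>
  If the mean value \<open>\<beta>\<close> of \<open>f'\<close> exists, then \<open>\<alpha> = \<beta> + c \<beta> / p\<close>, which determines it. For the existence,
  let \<open>b(N)\<close> be the deviation of the average of \<open>f'\<close> up to \<open>N\<close> from this value. Then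
  \<open>b(N) + (c/p) b(N div p)\<close> tends to \<open>0\<close>, and as \<open>1/p \<le> 1/2\<close>, so does \<open>b(N)\<close>.
\<close>

lemma mean_remove_prime:
  fixes f f' :: "nat \<Rightarrow> real"
  assumes p: "p \<ge> 2" and c: "\<bar>c\<bar> = 1"
    and f: "\<And>n. n > 0 \<Longrightarrow> f n = f' n + c * (if p dvd n then f' (n div p) else 0)"
    and bound: "\<And>n. \<bar>f' n\<bar> \<le> 1"
    and mean: "(\<lambda>N. (\<Sum>n=1..N. f n) / real N) \<longlonglongrightarrow> \<alpha>"
  shows "(\<lambda>N. (\<Sum>n=1..N. f' n) / real N) \<longlonglongrightarrow> \<alpha> / (1 + c / real p)"
proof -
  define \<beta> where "\<beta> = \<alpha> / (1 + c / real p)"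
  define F' where "F' N = (\<Sum>n=1..N. f' n)" for N
  define b where "b N = F' N / real N - \<beta>" for N
  define e where "e N = (\<Sum>n=1..N. f n) / real N - \<beta> - c * \<beta> * (real (N div p) / real N)" for N
  have "1 + c / real p \<noteq> 0"
    using p c by (auto simp: field_simps abs_if split: if_splits)
  hence "\<alpha> - \<beta> - c * \<beta> * (1 / real p) = 0"
    by (simp add: \<beta>_def field_simps)
  moreover have "e \<longlonglongrightarrow> \<alpha> - \<beta> - c * \<beta> * (1 / real p)"
    unfolding e_def by (intro tendsto_intros mean LIMSEQ_div_nat) (use p in auto)
  ultimately have e: "e \<longlonglongrightarrow> 0"
    by simp
  have sum_f: "(\<Sum>n=1..N. f n) = F' N + c * F' (N div p)" for N
  proof -
    have "(\<Sum>n=1..N. f n) = (\<Sum>n=1..N. f' n + c * (if p dvd n then f' (n div p) else 0))"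
      by (intro sum.cong f) auto
    also have "\<dots> = F' N + c * (\<Sum>n=1..N. if p dvd n then f' (n div p) else 0)"
      by (simp add: sum.distrib F'_def sum_distrib_left)
    also have "(\<Sum>n=1..N. if p dvd n then f' (n div p) else 0) = F' (N div p)"
      unfolding F'_def by (rule sum_multiples) (use p in auto)
    finally show ?thesis .
  qed
  have F'_bound: "\<bar>F' N\<bar> \<le> real N" for N
  proof -
    have "\<bar>F' N\<bar> \<le> (\<Sum>n=1..N. \<bar>f' n\<bar>)"
      unfolding F'_def by (rule sum_abs)
    also have "\<dots> \<le> (\<Sum>n=1..N. 1)"
      by (intro sum_mono bound)
    finally show ?thesis by simp
  qed
  have "b \<longlonglongrightarrow> 0"
  proof (rule contraction_tendsto_0)
    show "\<bar>b N\<bar> \<le> 1 + \<bar>\<beta>\<bar>" for N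
    proof -
      have "\<bar>F' N / real N\<bar> \<le> 1"
        using F'_bound[of N] by (cases "N = 0") auto
      thus ?thesis
        unfolding b_def by linarith
    qed
    show "\<bar>b N\<bar> \<le> \<bar>e N\<bar> + \<bar>b (N div p)\<bar> / 2" for N
    proof -
      define r where "r = real (N div p) / real N"
      have "r \<le> 1 / real p"
        using p of_nat_div_le_of_nat[of N p, where ?'a = real] by (cases "N = 0") (auto simp: r_def field_simps)
      also have "\<dots> \<le> 1 / 2"
        using p by (simp add: field_simps)
      finally have r: "r \<le> 1 / 2" .
      define y where "y = F' (N div p) / real (N div p)"
      have "F' (N div p) / real N = r * y"
        by (cases "N div p = 0") (auto simp: r_def y_def F'_def)
      hence "c * F' (N div p) / real N = c * (r * y)"
        by (metis times_divide_eq_right)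
      hence "e N = F' N / real N + c * (r * y) - \<beta> - c * \<beta> * r"
        by (simp only: e_def sum_f add_divide_distrib r_def)
      hence "b N = e N - c * (r * b (N div p))"
        by (simp add: b_def y_def algebra_simps)
      hence "\<bar>b N\<bar> \<le> \<bar>e N\<bar> + \<bar>c\<bar> * (\<bar>r\<bar> * \<bar>b (N div p)\<bar>)"
        using abs_triangle_ineq4[of "e N" "c * (r * b (N div p))"] by (simp add: abs_mult)
      also have "\<bar>r\<bar> * \<bar>b (N div p)\<bar> \<le> 1 / 2 * \<bar>b (N div p)\<bar>"
        using r by (intro mult_right_mono) (auto simp: r_def)
      finally show ?thesis
        using c by simp
    qed
    show "(\<lambda>N. \<bar>e N\<bar>) \<longlonglongrightarrow> 0"
      using e by (rule tendsto_rabs_zero)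
  qed (use p in auto)
  from tendsto_add[OF this tendsto_const[of \<beta>]] show ?thesis
    by (simp add: b_def F'_def \<beta>_def)
qed

text \<open>
  The condition on \<open>h\<close> holds for \<open>\<mu>\<close> with \<open>c = -1\<close> and for \<open>\<bar>\<mu>\<bar>\<close> with \<open>c = 1\<close>, so both averages are sieved
  at once. The primes are removed one at a time.
\<close>

lemma mean_coprime_to_primes:
  fixes h :: "nat \<Rightarrow> real"
  assumes "finite A" and "\<And>p. p \<in> A \<Longrightarrow> prime p" and c: "\<bar>c\<bar> = 1"
    and h: "\<And>p n. prime p \<Longrightarrow> h (p * n) = (if p dvd n then 0 else c * h n)"
    and bound: "\<And>n. \<bar>h n\<bar> \<le> 1"
    and mean: "(\<lambda>N. (\<Sum>n=1..N. h n) / real N) \<longlonglongrightarrow> \<alpha>"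
  shows "(\<lambda>N. (\<Sum>n=1..N. h n * of_bool (\<forall>p\<in>A. \<not> p dvd n)) / real N) \<longlonglongrightarrow> \<alpha> / (\<Prod>p\<in>A. 1 + c / real p)"
  using assms(1,2)
proof (induction A rule: finite_induct)
  case empty
  thus ?case using mean by simp
next
  case (insert p A)
  have p: "prime p" using insert by simp
  have "(\<lambda>N. (\<Sum>n=1..N. h n * of_bool (\<forall>q\<in>insert p A. \<not> q dvd n)) / real N) \<longlonglongrightarrow>
          (\<alpha> / (\<Prod>p\<in>A. 1 + c / real p)) / (1 + c / real p)"
  proof (rule mean_remove_prime[where f = "\<lambda>n. h n * of_bool (\<forall>q\<in>A. \<not> q dvd n)"])
    show "p \<ge> 2" using p by (rule prime_ge_2_nat)
    show "\<bar>c\<bar> = 1" by (rule c)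
    show "(\<lambda>N. (\<Sum>n=1..N. h n * of_bool (\<forall>q\<in>A. \<not> q dvd n)) / real N) \<longlonglongrightarrow> \<alpha> / (\<Prod>p\<in>A. 1 + c / real p)"
      using insert by simp
    show "\<bar>h n * of_bool (\<forall>q\<in>insert p A. \<not> q dvd n)\<bar> \<le> 1" for n
      using bound[of n] by auto
    fix n :: nat assume n: "n > 0"
    show "h n * of_bool (\<forall>q\<in>A. \<not> q dvd n) = h n * of_bool (\<forall>q\<in>insert p A. \<not> q dvd n) +
            c * (if p dvd n then h (n div p) * of_bool (\<forall>q\<in>insert p A. \<not> q dvd n div p) else 0)"
    proof (cases "p dvd n")
      case True
      then obtain m where m: "n = p * m" by auto
      have p0: "p > 0" using p prime_gt_0_nat by blast
      have "q dvd p * m \<longleftrightarrow> q dvd m" if "q \<in> A" for q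
      proof -
        have "prime q" "q \<noteq> p" using insert that by auto
        thus ?thesis
          using p by (metis prime_dvd_mult_iff primes_dvd_imp_eq)
      qed
      thus ?thesis
        using p p0 by (simp add: m h)
    qed simp
  qed
  moreover have "(\<alpha> / (\<Prod>p\<in>A. 1 + c / real p)) / (1 + c / real p) = \<alpha> / (\<Prod>p\<in>insert p A. 1 + c / real p)"
    using insert by (simp add: mult.commute)
  ultimately show ?case by (simp only:)
qed

text \<open>
  The indicator of \<open>\<mu>(n) = \<sigma>\<close> is \<open>(\<bar>\<mu>(n)\<bar> + \<sigma> \<mu>(n)) / 2\<close>: the first part has half the density of the
  squarefree numbers as its mean value, the second one has mean value \<open>0\<close>.
\<close>

theorem mean_moebius_eq_coprime:
  assumes "finite A" and "\<And>p. p \<in> A \<Longrightarrow> prime p" and \<sigma>: "\<sigma> \<in> {-1, 1}"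
  shows "(\<lambda>N. (\<Sum>n=1..N. of_bool (moebius_mu n = \<sigma> \<and> (\<forall>p\<in>A. \<not> p dvd n))) / real N) \<longlonglongrightarrow>
           3 / (pi\<^sup>2 * (\<Prod>p\<in>A. 1 + 1 / real p))"
proof -
  define C :: "nat \<Rightarrow> real" where "C n = of_bool (\<forall>p\<in>A. \<not> p dvd n)" for n
  define u where "u n = \<bar>real_of_int (moebius_mu n)\<bar> * C n" for n
  define v where "v n = real_of_int (moebius_mu n) * C n" for n
  have v: "(\<lambda>N. (\<Sum>n=1..N. v n) / real N) \<longlonglongrightarrow> 0 / (\<Prod>p\<in>A. 1 + (-1) / real p)"
    unfolding v_def C_def
    by (rule mean_coprime_to_primes[OF assms(1,2)])
       (use mean_moebius_mu abs_moebius_mu_le_1 in \<open>auto simp: moebius_mu_prime_mult\<close>)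
  have sq: "\<bar>real_of_int (moebius_mu n)\<bar> = of_bool (squarefree n)" for n
    by (simp add: moebius_mu_def power_abs)
  have u: "(\<lambda>N. (\<Sum>n=1..N. u n) / real N) \<longlonglongrightarrow> (6 / pi\<^sup>2) / (\<Prod>p\<in>A. 1 + 1 / real p)"
    unfolding u_def C_def
  proof (rule mean_coprime_to_primes[OF assms(1,2)])
    show "(\<lambda>N. (\<Sum>n=1..N. \<bar>real_of_int (moebius_mu n)\<bar>) / real N) \<longlonglongrightarrow> 6 / pi\<^sup>2"
      using mean_squarefree by (simp only: sq)
  qed (use abs_moebius_mu_le_1 in \<open>auto simp: moebius_mu_prime_mult\<close>)
  have "of_bool (moebius_mu n = \<sigma> \<and> (\<forall>p\<in>A. \<not> p dvd n)) = u n / 2 + of_int \<sigma> / 2 * v n" for n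
    using moebius_mu_cases[of n] \<sigma> by (auto simp: u_def v_def C_def)
  hence "(\<Sum>n=1..N. of_bool (moebius_mu n = \<sigma> \<and> (\<forall>p\<in>A. \<not> p dvd n))) / real N =
      ((\<Sum>n=1..N. u n) / real N) / 2 + of_int \<sigma> / 2 * ((\<Sum>n=1..N. v n) / real N)" for N
    by (simp add: sum.distrib sum_divide_distrib sum_distrib_left add_divide_distrib mult_ac)
  moreover have "(\<lambda>N. ((\<Sum>n=1..N. u n) / real N) / 2 + of_int \<sigma> / 2 * ((\<Sum>n=1..N. v n) / real N)) \<longlonglongrightarrow>
      (6 / pi\<^sup>2) / (\<Prod>p\<in>A. 1 + 1 / real p) / 2 + of_int \<sigma> / 2 * (0 / (\<Prod>p\<in>A. 1 + (-1) / real p))"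
    by (intro tendsto_add tendsto_mult tendsto_divide tendsto_const u v) auto
  moreover have "(6 / pi\<^sup>2) / (\<Prod>p\<in>A. 1 + 1 / real p) / 2 + of_int \<sigma> / 2 * (0 / (\<Prod>p\<in>A. 1 + (-1) / real p))
       = 3 / (pi\<^sup>2 * (\<Prod>p\<in>A. 1 + 1 / real p))"
    by simp
  ultimately show ?thesis
    by (simp only:)
qed

section \<open>The coefficients and smooth divisors\<close>

text \<open>
  With \<open>r = x\<^bsup>k+1\<^esup>\<close>, this lemma and the next one say that the power series congruent to \<open>1\<close> modulo \<open>r\<close> are closed
  under integer powers and products; so factors \<open>1 - x\<^sup>d\<close> with \<open>d > k\<close> do not influence the
  \<open>k\<close>-th coefficient.
\<close>

lemma dvd_power_int_minus_1:
  fixes A :: "'a :: field fps"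
  assumes A: "fps_nth A 0 \<noteq> 0" and dvd: "r dvd A - 1"
  shows "r dvd A powi i - 1"
proof -
  have pow: "r dvd B ^ j - 1" if "r dvd B - 1" for B :: "'a fps" and j
  proof (induction j)
    case (Suc j)
    have "B ^ Suc j - 1 = B * (B ^ j - 1) + (B - 1)"
      by (simp add: algebra_simps)
    thus ?case
      using Suc that by (metis dvd_add dvd_mult)
  qed auto
  have "inverse A - 1 = - (inverse A * (A - 1))"
    using inverse_mult_eq_1[OF A] by (simp add: right_diff_distrib)
  hence "r dvd inverse A - 1"
    using dvd by (metis dvd_minus_iff dvd_mult)
  thus ?thesis
    using pow dvd by (auto simp: power_int_def)
qed

lemma dvd_prod_minus_1:
  fixes f :: "'b \<Rightarrow> 'a :: comm_ring_1"
  assumes "\<And>x. x \<in> A \<Longrightarrow> r dvd f x - 1"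
  shows "r dvd prod f A - 1"
  using assms
proof (induction A rule: infinite_finite_induct)
  case (insert x A)
  have "prod f (insert x A) - 1 = f x * (prod f A - 1) + (f x - 1)"
    using insert by (simp add: right_diff_distrib)
  moreover have "r dvd prod f A - 1" "r dvd f x - 1"
    using insert by auto
  ultimately show ?case
    by (simp only: dvd_add dvd_mult)
qed auto

lemma cyclo_coeff_truncate:
  assumes "n \<ge> 1"
  shows "cyclo_coeff \<epsilon> n k =
    fps_nth (\<Prod>d | d dvd n \<and> d \<le> k. (1 - fps_X ^ d) powi (\<epsilon> * moebius_mu (n div d))) k"
proof -
  define F :: "nat \<Rightarrow> real fps" where "F d = (1 - fps_X ^ d) powi (\<epsilon> * moebius_mu (n div d))" for d
  define A B where "A = {d. d dvd n \<and> d \<le> k}" and "B = {d. d dvd n \<and> d > k}"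
  have fin: "finite A" "finite B" and AB: "{d. d dvd n} = A \<union> B" "A \<inter> B = {}"
    using assms by (auto simp: A_def B_def)
  have "fps_X ^ Suc k dvd prod F B - 1"
  proof (rule dvd_prod_minus_1)
    fix d assume "d \<in> B"
    hence d: "d \<ge> Suc k" by (simp add: B_def)
    show "fps_X ^ Suc k dvd F d - 1"
      unfolding F_def using d by (intro dvd_power_int_minus_1) (auto simp: le_imp_power_dvd simp del: power_Suc)
  qed
  then obtain H where H: "prod F B - 1 = fps_X ^ Suc k * H"
    by (auto elim: dvdE)
  have "prod F {d. d dvd n} = prod F A * prod F B"
    using fin AB by (simp add: prod.union_disjoint)
  also have "\<dots> = prod F A + fps_X ^ Suc k * (H * prod F A)"
    using arg_cong[OF H, of "\<lambda>x. prod F A * (1 + x)"] by (simp add: algebra_simps)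
  finally have "fps_nth (prod F {d. d dvd n}) k = fps_nth (prod F A) k"
    by (simp add: fps_X_power_mult_nth del: power_Suc)
  thus ?thesis
    using cyclo_coeff_eq_fps_nth[OF assms, of \<epsilon> k] by (simp add: F_def A_def)
qed

lemma cyclo_coeff_0_left:
  assumes "n \<ge> 1" and "k \<ge> 1"
  shows "cyclo_coeff 0 n k = 0"
  using assms by (simp add: cyclo_coeff_eq_fps_nth)

definition smooth_upto :: "nat \<Rightarrow> nat \<Rightarrow> bool" where
  "smooth_upto k s \<longleftrightarrow> (\<forall>p. prime p \<longrightarrow> p dvd s \<longrightarrow> p \<le> k)"

definition rough_upto :: "nat \<Rightarrow> nat \<Rightarrow> bool" where
  "rough_upto k m \<longleftrightarrow> (\<forall>p. prime p \<longrightarrow> p \<le> k \<longrightarrow> \<not> p dvd m)"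

lemma coprime_smooth_rough:
  assumes "smooth_upto k s" and "rough_upto k m"
  shows "coprime s m"
proof (rule ccontr)
  assume "\<not> coprime s m"
  hence "gcd s m \<noteq> 1"
    by (simp add: coprime_iff_gcd_eq_1)
  then obtain p where "prime p" "p dvd gcd s m"
    using prime_factor_nat by blast
  thus False
    using assms by (auto simp: smooth_upto_def rough_upto_def)
qed

lemma smooth_upto_dvd: "smooth_upto k s \<Longrightarrow> d dvd s \<Longrightarrow> smooth_upto k d"
  by (auto simp: smooth_upto_def intro: dvd_trans)

lemma smooth_upto_le:
  assumes "0 < d" "d \<le> k"
  shows "smooth_upto k d"
  using assms by (auto simp: smooth_upto_def dest!: dvd_imp_le)

lemma smooth_rough_decomposition:
  assumes "n > 0"
  shows "\<exists>s m. n = s * m \<and> smooth_upto k s \<and> rough_upto k m"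
  using assms
proof (induction n rule: less_induct)
  case (less n)
  show ?case
  proof (cases "rough_upto k n")
    case True
    thus ?thesis
      by (intro exI[of _ 1] exI[of _ n]) (auto simp: smooth_upto_def)
  next
    case False
    then obtain p where p: "prime p" "p \<le> k" "p dvd n"
      by (auto simp: rough_upto_def)
    then obtain n' where n': "n = p * n'" by auto
    have "n' < n" "n' > 0"
      using n' less.prems prime_gt_1_nat[OF p(1)] by auto
    then obtain s m where sm: "n' = s * m" "smooth_upto k s" "rough_upto k m"
      using less.IH by blast
    have "smooth_upto k (p * s)"
      using sm(2) p by (auto simp: smooth_upto_def prime_dvd_mult_iff dest: primes_dvd_imp_eq)
    with sm n' show ?thesis
      by (intro exI[of _ "p * s"] exI[of _ m]) (auto simp: mult.assoc)
  qed
qed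

lemma smooth_rough_decomposition_unique:
  assumes "s * m = s' * m'" "smooth_upto k s" "rough_upto k m" "smooth_upto k s'" "rough_upto k m'"
  shows "s = s'"
proof (rule dvd_antisym)
  have "coprime s m'" "coprime s' m"
    using assms coprime_smooth_rough by blast+
  thus "s dvd s'" "s' dvd s"
    using assms(1) by (metis coprime_dvd_mult_left_iff dvd_triv_left)+
qed

text \<open>
  A divisor \<open>d \<le> k\<close> of \<open>s m\<close> divides \<open>s\<close>, as it is coprime to \<open>m\<close>, and \<open>\<mu>(s m / d) = \<mu>(m) \<mu>(s / d)\<close>.
  For \<open>\<mu>(m) = 0\<close> the right-hand side is a coefficient of the constant \<open>1\<close>.
\<close>

lemma cyclo_coeff_smooth_rough:
  assumes s: "smooth_upto k s" "s > 0" and m: "rough_upto k m" "m > 0"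
  shows "cyclo_coeff \<epsilon> (s * m) k = cyclo_coeff (\<epsilon> * moebius_mu m) s k"
proof -
  have "d dvd s * m \<longleftrightarrow> d dvd s" if "d \<le> k" for d
  proof (cases "d = 0")
    case False
    hence "coprime d m"
      using that m by (intro coprime_smooth_rough[of k] smooth_upto_le) auto
    thus ?thesis
      by (simp add: coprime_dvd_mult_left_iff)
  qed (use s m in auto)
  hence eq: "{d. d dvd s * m \<and> d \<le> k} = {d. d dvd s \<and> d \<le> k}"
    by auto
  have mu: "moebius_mu (s * m div d) = moebius_mu m * moebius_mu (s div d)" if "d dvd s" for d
  proof -
    have "s * m div d = (s div d) * m"
      using that by (simp add: div_mult_swap mult.commute)
    moreover have "s div d dvd s"
      using that by (metis dvd_div_mult_self dvd_triv_left)
    hence "coprime (s div d) m"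
      using coprime_smooth_rough smooth_upto_dvd s(1) m(1) by blast
    ultimately show ?thesis
      by (simp add: moebius_mu_mult)
  qed
  have "cyclo_coeff \<epsilon> (s * m) k =
     fps_nth (\<Prod>d | d dvd s \<and> d \<le> k. (1 - fps_X ^ d) powi (\<epsilon> * moebius_mu (s * m div d))) k"
    using s m by (subst cyclo_coeff_truncate) (auto simp: eq)
  also have "(\<Prod>d | d dvd s \<and> d \<le> k. (1 - fps_X ^ d) powi (\<epsilon> * moebius_mu (s * m div d)) :: real fps) =
     (\<Prod>d | d dvd s \<and> d \<le> k. (1 - fps_X ^ d) powi (\<epsilon> * moebius_mu m * moebius_mu (s div d)))"
    by (intro prod.cong refl) (simp add: mu mult.assoc)
  also have "fps_nth \<dots> k = cyclo_coeff (\<epsilon> * moebius_mu m) s k"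
    using s by (subst cyclo_coeff_truncate) auto
  finally show ?thesis .
qed

text \<open>
  \<open>F\<close> is a power series in \<open>x\<^sup>q\<close>. For \<open>q = 0\<close> these are the constants.
\<close>

definition fps_in_X_power :: "nat \<Rightarrow> 'a :: zero fps \<Rightarrow> bool" where
  "fps_in_X_power q F \<longleftrightarrow> (\<forall>j. fps_nth F j \<noteq> 0 \<longrightarrow> q dvd j)"

lemma fps_in_X_power_1: "fps_in_X_power q (1 :: 'a :: zero_neq_one fps)"
  by (auto simp: fps_in_X_power_def fps_one_def)

lemma fps_in_X_power_mult:
  fixes F G :: "'a :: semiring_0 fps"
  assumes "fps_in_X_power q F" "fps_in_X_power q G"
  shows "fps_in_X_power q (F * G)"
  unfolding fps_in_X_power_def
proof (intro allI impI)
  fix j assume "fps_nth (F * G) j \<noteq> 0"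
  then obtain i where i: "i \<le> j" "fps_nth F i * fps_nth G (j - i) \<noteq> 0"
    unfolding fps_mult_nth by (elim sum.not_neutral_contains_not_neutral) auto
  hence "fps_nth F i \<noteq> 0" "fps_nth G (j - i) \<noteq> 0"
    by auto
  thus "q dvd j"
    using assms i(1) by (metis fps_in_X_power_def dvd_add le_add_diff_inverse)
qed

text \<open>
  If \<open>j\<close> is the least index violating the claim, then all but the last summand in the \<open>j\<close>-th coefficient
  of \<open>F\<^bsup>-1\<^esup> F = 1\<close> vanish.
\<close>

lemma fps_in_X_power_inverse:
  fixes F :: "'a :: field fps"
  assumes F: "fps_in_X_power q F" "fps_nth F 0 \<noteq> 0"
  shows "fps_in_X_power q (inverse F)"
proof -
  have "q dvd j" if "fps_nth (inverse F) j \<noteq> 0" for j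
    using that
  proof (induction j rule: less_induct)
    case (less j)
    show ?case
    proof (rule ccontr)
      assume ndvd: "\<not> q dvd j"
      hence j: "j \<noteq> 0" by (metis dvd_0_right)
      have zero: "fps_nth (inverse F) i * fps_nth F (j - i) = 0" if "i < j" for i
      proof (rule ccontr)
        assume "fps_nth (inverse F) i * fps_nth F (j - i) \<noteq> 0"
        hence "q dvd i" "q dvd j - i"
          using less.IH[OF that] F(1) by (auto simp: fps_in_X_power_def)
        thus False
          using ndvd that by (metis dvd_add le_add_diff_inverse less_imp_le)
      qed
      have "0 = fps_nth (inverse F * F) j"
        using F(2) j by (simp add: inverse_mult_eq_1)
      also have "\<dots> = (\<Sum>i=0..j. fps_nth (inverse F) i * fps_nth F (j - i))"
        by (rule fps_mult_nth)
      also have "\<dots> = (\<Sum>i\<in>{j}. fps_nth (inverse F) i * fps_nth F (j - i))"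
        by (intro sum.mono_neutral_right ballI zero) auto
      finally show False
        using less.prems F(2) by simp
    qed
  qed
  thus ?thesis
    by (simp add: fps_in_X_power_def)
qed

lemma fps_in_X_power_power_int:
  fixes F :: "'a :: field fps"
  assumes F: "fps_in_X_power q F" "fps_nth F 0 \<noteq> 0"
  shows "fps_in_X_power q (F powi i)"
proof -
  have "fps_in_X_power q (G ^ j)" if "fps_in_X_power q G" for G :: "'a fps" and j
    using that by (induction j) (auto intro: fps_in_X_power_1 fps_in_X_power_mult)
  thus ?thesis
    using F fps_in_X_power_inverse[OF F] by (auto simp: power_int_def)
qed

lemma fps_in_X_power_prod:
  fixes f :: "'b \<Rightarrow> 'a :: comm_ring_1 fps"
  assumes "\<And>x. x \<in> A \<Longrightarrow> fps_in_X_power q (f x)"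
  shows "fps_in_X_power q (prod f A)"
  using assms
  by (induction A rule: infinite_finite_induct) (auto intro: fps_in_X_power_1 fps_in_X_power_mult)

lemma squarefree_dvd_if_primes_dvd:
  fixes e n :: nat
  assumes "squarefree e" and "n \<noteq> 0" and "\<And>p. prime p \<Longrightarrow> p dvd e \<Longrightarrow> p dvd n"
  shows "e dvd n"
proof (rule multiplicity_le_imp_dvd)
  show "e \<noteq> 0"
    using assms(1) by (metis not_squarefree_0)
  fix p :: nat assume p: "prime p"
  show "multiplicity p e \<le> multiplicity p n"
  proof (cases "p dvd e")
    case True
    have "multiplicity p e \<le> 1"
      using assms(1) p squarefree_factorial_semiring''[of e] by (metis not_squarefree_0)
    also have "1 \<le> multiplicity p n"
      using assms(2) assms(3)[OF p True] p by (simp add: prime_multiplicity_gt_zero_iff Suc_le_eq prime_imp_prime_elem)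
    finally show ?thesis .
  qed (simp add: not_dvd_imp_multiplicity_0)
qed

lemma primes_upto_dvd_prod:
  "prime p \<Longrightarrow> p \<le> k \<Longrightarrow> p dvd (\<Prod>p | prime p \<and> p \<le> (k::nat). p)"
  by (rule dvd_prodI) auto

lemma big_M_pos: "k \<ge> 1 \<Longrightarrow> big_M k > 0"
  by (auto simp: big_M_def prime_gt_0_nat intro!: prod_pos)

lemma smooth_upto_dvd_big_M:
  assumes "k \<ge> 1" and "s dvd big_M k"
  shows "smooth_upto k s"
  unfolding smooth_upto_def
proof (intro allI impI)
  fix p assume p: "prime p" "p dvd s"
  define A where "A = {p. prime p \<and> p \<le> k}"
  have A: "finite A"
    by (rule finite_subset[of _ "{..k}"]) (auto simp: A_def)
  have "p dvd k * \<Prod>A"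
    using dvd_trans[OF p(2) assms(2)] by (simp add: big_M_def A_def)
  hence "p dvd k \<or> (\<exists>q\<in>A. p dvd q)"
    using p(1) A by (simp add: prime_dvd_mult_iff prime_dvd_prod_iff)
  thus "p \<le> k"
  proof
    assume "p dvd k"
    thus ?thesis using assms(1) by (auto dest: dvd_imp_le)
  next
    assume "\<exists>q\<in>A. p dvd q"
    then obtain q where "prime q" "q \<le> k" "p dvd q"
      by (auto simp: A_def)
    thus ?thesis
      using primes_dvd_imp_eq[OF p(1)] by auto
  qed
qed

text \<open>
  Let \<open>Q\<close> be the product of the primes up to \<open>k\<close> and \<open>q = s / gcd s Q\<close>. If \<open>s/d\<close> is squarefree, it
  divides \<open>Q\<close>, as \<open>s\<close> is smooth; so it divides \<open>gcd s Q\<close>, that is, \<open>q\<close> divides \<open>d\<close>. Hence only powers of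
  \<open>x\<^sup>q\<close> occur in the product. A nonzero \<open>k\<close>-th coefficient thus implies \<open>q dvd k\<close>, and
  \<open>s = q gcd s Q\<close> divides \<open>k Q\<close>.
\<close>

lemma cyclo_coeff_nonzero_imp_dvd_big_M:
  assumes s: "smooth_upto k s" "s > 0" and nz: "cyclo_coeff \<epsilon> s k \<noteq> 0"
  shows "s dvd big_M k"
proof -
  define Q where "Q = (\<Prod>p | prime p \<and> p \<le> k. p)"
  have Q: "Q \<noteq> 0"
    by (auto simp: Q_def)
  define q where "q = s div gcd s Q"
  have sq: "s = q * gcd s Q"
    by (simp add: q_def)
  have q_dvd: "q dvd d" if d: "d dvd s" "moebius_mu (s div d) \<noteq> 0" for d
  proof -
    define e where "e = s div d"
    have e: "s = d * e"
      using d by (simp add: e_def)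
    have sf: "squarefree e"
      using d(2) by (auto simp: e_def moebius_mu_def split: if_splits)
    have "p dvd Q" if "prime p" "p dvd e" for p
    proof -
      have "p \<le> k"
        using s(1) that e by (auto simp: smooth_upto_def)
      thus ?thesis
        using that unfolding Q_def by (intro primes_upto_dvd_prod)
    qed
    with sf Q have "e dvd Q"
      by (rule squarefree_dvd_if_primes_dvd)
    hence "e dvd gcd s Q"
      using e by simp
    then obtain c where "gcd s Q = e * c" by (elim dvdE)
    hence "d * e = (q * c) * e"
      using sq e by (simp add: mult_ac)
    hence "d = q * c"
      using e s(2) by auto
    thus ?thesis by simp
  qed
  have "fps_in_X_power q (\<Prod>d | d dvd s. (1 - fps_X ^ d) powi (\<epsilon> * moebius_mu (s div d)) :: real fps)"
  proof (rule fps_in_X_power_prod)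
    fix d assume "d \<in> {d. d dvd s}"
    hence d: "d dvd s" "d > 0"
      using s by (auto intro: Nat.gr0I)
    show "fps_in_X_power q ((1 - fps_X ^ d) powi (\<epsilon> * moebius_mu (s div d)) :: real fps)"
    proof (cases "moebius_mu (s div d) = 0")
      case False
      have "fps_in_X_power q (1 - fps_X ^ d :: real fps)"
        using q_dvd[OF d(1) False] by (auto simp: fps_in_X_power_def fps_X_power_iff fps_one_def split: if_splits)
      thus ?thesis
        using d by (intro fps_in_X_power_power_int) auto
    qed (simp add: fps_in_X_power_1)
  qed
  hence "q dvd k"
    using nz s by (auto simp: cyclo_coeff_eq_fps_nth fps_in_X_power_def)
  hence "q * gcd s Q dvd k * Q"
    by (intro mult_dvd_mono) auto
  thus ?thesis
    using sq by (simp add: big_M_def Q_def)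
qed

text \<open>
  At most one \<open>s\<close> contributes, namely the smooth part of \<open>n\<close>, and only with \<open>\<sigma> = \<mu>(n/s)\<close>. The function
  \<open>w\<close> allows for treating the coefficient itself and the indicator of a nonzero value alike.
\<close>

lemma cyclo_coeff_decompose:
  fixes w :: "real \<Rightarrow> real"
  assumes w: "w 0 = 0" and k: "k \<ge> 1" and n: "n \<ge> 1"
  shows "w (cyclo_coeff \<epsilon> n k) = (\<Sum>s | s dvd big_M k. \<Sum>\<sigma>\<in>{-1, 1}.
           w (cyclo_coeff (\<epsilon> * \<sigma>) s k) *
           (if s dvd n then of_bool (moebius_mu (n div s) = \<sigma> \<and> rough_upto k (n div s)) else 0))"
proof -
  obtain t m where tm: "n = t * m" "smooth_upto k t" "rough_upto k m"
    using smooth_rough_decomposition[of n k] n by auto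
  have pos: "t > 0" "m > 0"
    using n tm by (auto intro: Nat.gr0I)
  define T where "T s = (\<Sum>\<sigma>\<in>{-1, 1}. w (cyclo_coeff (\<epsilon> * \<sigma>) s k) *
           (if s dvd n then of_bool (moebius_mu (n div s) = \<sigma> \<and> rough_upto k (n div s)) else 0))" for s
  have val: "cyclo_coeff \<epsilon> n k = cyclo_coeff (\<epsilon> * moebius_mu m) t k"
    using tm pos by (simp add: cyclo_coeff_smooth_rough)
  have T_t: "T t = w (cyclo_coeff \<epsilon> n k)"
  proof -
    have "t dvd n" "n div t = m"
      using tm(1) pos by auto
    thus ?thesis
      using moebius_mu_cases[of m] pos tm(3) w k
      by (auto simp: T_def val cyclo_coeff_0_left)
  qed
  have T_other: "T s = 0" if s: "s dvd big_M k" "s \<noteq> t" for s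
  proof -
    have "\<not> (s dvd n \<and> rough_upto k (n div s))"
    proof
      assume *: "s dvd n \<and> rough_upto k (n div s)"
      hence "s * (n div s) = t * m"
        using tm by simp
      hence "s = t"
        by (rule smooth_rough_decomposition_unique)
           (use * tm(2,3) smooth_upto_dvd_big_M[OF k s(1)] in auto)
      with s(2) show False ..
    qed
    thus ?thesis
      by (auto simp: T_def)
  qed
  have fin: "finite {s. s dvd big_M k}"
    using big_M_pos[OF k] by auto
  have "(\<Sum>s | s dvd big_M k. T s) = w (cyclo_coeff \<epsilon> n k)"
  proof (cases "t dvd big_M k")
    case True
    have "(\<Sum>s | s dvd big_M k. T s) = (\<Sum>s\<in>{t}. T s)"
      using fin True T_other by (intro sum.mono_neutral_right) auto
    thus ?thesis by (simp add: T_t)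
  next
    case False
    hence "cyclo_coeff \<epsilon> n k = 0"
      using cyclo_coeff_nonzero_imp_dvd_big_M[OF tm(2) pos(1), of "\<epsilon> * moebius_mu m"] unfolding val by blast
    moreover have "(\<Sum>s | s dvd big_M k. T s) = 0"
      using T_other False by (intro sum.neutral) auto
    ultimately show ?thesis
      using w by simp
  qed
  thus ?thesis
    by (simp add: T_def)
qed

section \<open>Averaging over rough cofactors\<close>

text \<open>
  The numbers \<open>n = s m\<close> with \<open>m\<close> free of primes up to \<open>k\<close> and \<open>\<mu>(m) = \<sigma>\<close> have density \<open>D / s\<close>
  for both signs \<open>\<sigma>\<close>. So the result does not depend on \<open>\<epsilon>\<close>: changing it merely swaps the two signs.
\<close>

lemma LIMSEQ_mean_cyclo_coeff:
  fixes w :: "real \<Rightarrow> real"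
  assumes w: "w 0 = 0" and k: "k \<ge> 1" and \<epsilon>: "\<epsilon> \<in> {-1, 1}"
  shows "(\<lambda>N. (\<Sum>n=1..N. w (cyclo_coeff \<epsilon> n k)) / real N) \<longlonglongrightarrow>
           3 / (pi\<^sup>2 * (\<Prod>p | prime p \<and> p \<le> k. 1 + 1 / real p)) *
           (\<Sum>d | d dvd big_M k. (w (cyclo_coeff 1 d k) + w (cyclo_coeff (-1) d k)) / real d)"
proof -
  define D where "D = 3 / (pi\<^sup>2 * (\<Prod>p | prime p \<and> p \<le> k. 1 + 1 / real p))"
  define f :: "int \<Rightarrow> nat \<Rightarrow> real" where
    "f \<sigma> m = of_bool (moebius_mu m = \<sigma> \<and> rough_upto k m)" for \<sigma> m
  define I :: "int \<Rightarrow> nat \<Rightarrow> nat \<Rightarrow> real" where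
    "I \<sigma> s n = (if s dvd n then f \<sigma> (n div s) else 0)" for \<sigma> s n
  have fin: "finite {p. prime p \<and> p \<le> k}"
    by (rule finite_subset[of _ "{..k}"]) auto
  have f: "(\<lambda>N. (\<Sum>n=1..N. f \<sigma> n) / real N) \<longlonglongrightarrow> D" if "\<sigma> \<in> {-1, 1}" for \<sigma>
  proof -
    have "f \<sigma> n = of_bool (moebius_mu n = \<sigma> \<and> (\<forall>p\<in>{p. prime p \<and> p \<le> k}. \<not> p dvd n))" for n
      by (auto simp: f_def rough_upto_def)
    thus ?thesis
      using mean_moebius_eq_coprime[OF fin _ that] by (simp only: D_def mem_Collect_eq)
  qed
  have I: "(\<lambda>N. (\<Sum>n=1..N. I \<sigma> s n) / real N) \<longlonglongrightarrow> D / real s"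
    if "\<sigma> \<in> {-1, 1}" "s dvd big_M k" for \<sigma> s
    unfolding I_def using that big_M_pos[OF k] by (intro LIMSEQ_mean_multiples f) (auto intro: Nat.gr0I)
  have "(\<Sum>n=1..N. w (cyclo_coeff \<epsilon> n k)) / real N =
          (\<Sum>s | s dvd big_M k. \<Sum>\<sigma>\<in>{-1, 1}. w (cyclo_coeff (\<epsilon> * \<sigma>) s k) * ((\<Sum>n=1..N. I \<sigma> s n) / real N))" for N
  proof -
    have "(\<Sum>n=1..N. w (cyclo_coeff \<epsilon> n k)) =
            (\<Sum>n=1..N. \<Sum>s | s dvd big_M k. \<Sum>\<sigma>\<in>{-1, 1}. w (cyclo_coeff (\<epsilon> * \<sigma>) s k) * I \<sigma> s n)"
      unfolding I_def f_def by (intro sum.cong refl cyclo_coeff_decompose[where w = w, OF w k]) auto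
    also have "\<dots> = (\<Sum>s | s dvd big_M k. \<Sum>n=1..N. \<Sum>\<sigma>\<in>{-1, 1}. w (cyclo_coeff (\<epsilon> * \<sigma>) s k) * I \<sigma> s n)"
      by (rule sum.swap)
    also have "\<dots> = (\<Sum>s | s dvd big_M k. \<Sum>\<sigma>\<in>{-1, 1}. \<Sum>n=1..N. w (cyclo_coeff (\<epsilon> * \<sigma>) s k) * I \<sigma> s n)"
      by (intro sum.cong refl sum.swap)
    also have "\<dots> / real N = (\<Sum>s | s dvd big_M k. \<Sum>\<sigma>\<in>{-1, 1}.
                 w (cyclo_coeff (\<epsilon> * \<sigma>) s k) * ((\<Sum>n=1..N. I \<sigma> s n) / real N))"
      by (simp only: sum_divide_distrib sum_distrib_left times_divide_eq_right)
    finally show ?thesis .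
  qed
  moreover have "(\<lambda>N. \<Sum>s | s dvd big_M k. \<Sum>\<sigma>\<in>{-1, 1}. w (cyclo_coeff (\<epsilon> * \<sigma>) s k) * ((\<Sum>n=1..N. I \<sigma> s n) / real N))
      \<longlonglongrightarrow> (\<Sum>s | s dvd big_M k. \<Sum>\<sigma>\<in>{-1, 1}. w (cyclo_coeff (\<epsilon> * \<sigma>) s k) * (D / real s))"
    by (intro tendsto_sum tendsto_mult tendsto_const I) auto
  moreover have "(\<Sum>s | s dvd big_M k. \<Sum>\<sigma>\<in>{-1, 1}. w (cyclo_coeff (\<epsilon> * \<sigma>) s k) * (D / real s)) =
      D * (\<Sum>s | s dvd big_M k. (w (cyclo_coeff 1 s k) + w (cyclo_coeff (-1) s k)) / real s)"
    unfolding sum_distrib_left using \<epsilon> by (intro sum.cong refl) (auto simp: add_divide_distrib distrib_left mult_ac)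
  ultimately show ?thesis
    by (simp only: D_def)
qed

theorem theorem4:
  fixes k :: nat and \<epsilon> :: int
  assumes "k \<ge> 1" and "\<epsilon> \<in> {-1, 1}"
  shows "has_mean_value (\<lambda>n. cyclo_coeff \<epsilon> n k)
           (3 / (pi\<^sup>2 * (\<Prod>p | prime p \<and> p \<le> k. 1 + 1 / real p)) *
             (\<Sum>d | d dvd big_M k. (cyclo_coeff 1 d k + cyclo_coeff (-1) d k) / real d)) \<and>
         (\<forall>v::int. v \<noteq> 0 \<longrightarrow>
           has_density (\<lambda>n. cyclo_coeff \<epsilon> n k = of_int v)
             (3 / (pi\<^sup>2 * (\<Prod>p | prime p \<and> p \<le> k. 1 + 1 / real p)) *
               ((\<Sum>d | d dvd big_M k \<and> cyclo_coeff 1 d k = of_int v. 1 / real d) +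
                (\<Sum>d | d dvd big_M k \<and> cyclo_coeff (-1) d k = of_int v. 1 / real d))))"
proof (intro conjI allI impI)
  show "has_mean_value (\<lambda>n. cyclo_coeff \<epsilon> n k)
           (3 / (pi\<^sup>2 * (\<Prod>p | prime p \<and> p \<le> k. 1 + 1 / real p)) *
             (\<Sum>d | d dvd big_M k. (cyclo_coeff 1 d k + cyclo_coeff (-1) d k) / real d))"
    using LIMSEQ_mean_cyclo_coeff[where w = "\<lambda>x. x", OF _ assms] by (intro LIMSEQ_imp_has_mean_value) simp
next
  fix v :: int assume v: "v \<noteq> 0"
  define w :: "real \<Rightarrow> real" where "w x = of_bool (x = of_int v)" for x
  have fin: "finite {d. d dvd big_M k}"
    using big_M_pos[OF assms(1)] by auto
  have restrict: "(\<Sum>d | d dvd big_M k \<and> cyclo_coeff \<delta> d k = of_int v. 1 / real d) =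
          (\<Sum>d | d dvd big_M k. w (cyclo_coeff \<delta> d k) / real d)" for \<delta>
    using fin by (intro sum.mono_neutral_cong_left) (auto simp: w_def)
  have "w 0 = 0"
    using v by (simp add: w_def)
  from LIMSEQ_imp_has_mean_value[OF LIMSEQ_mean_cyclo_coeff[where w = w, OF this assms]]
  show "has_density (\<lambda>n. cyclo_coeff \<epsilon> n k = of_int v)
             (3 / (pi\<^sup>2 * (\<Prod>p | prime p \<and> p \<le> k. 1 + 1 / real p)) *
               ((\<Sum>d | d dvd big_M k \<and> cyclo_coeff 1 d k = of_int v. 1 / real d) +
                (\<Sum>d | d dvd big_M k \<and> cyclo_coeff (-1) d k = of_int v. 1 / real d)))"
    unfolding has_density_iff_has_mean_value restrict
    by (simp add: w_def add_divide_distrib sum.distrib)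
qed

end
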